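(* Let $I$ be a countable set, $\mathcal X=(X_\alpha)_{\alpha\in I}$ a family of non-trivial Banach spaces and $E$ a Banach ideal space over the counting measure space $(I,2^I,m)$. Put $\mathcal X^*=(X_\alpha^* )_{\alpha\in I}$. 1. If $E$ is order continuous and $E^*$ is order continuous, then $\left(E(\mathcal X),\|\cdot\|_{E(\mathcal X)}\right)^*\equiv\left(E^*(\mathcal X^* ),\|\cdot\|_{E^*(\mathcal X^* )}\right)$, i.e. the dual of $E(\mathcal X)$ is $E^*(\mathcal X^* )$ with equality of norms. 2. If $E$ and $X_\alpha$, for each $\alpha\in I$, are reflexive, then $E(\mathcal X)$ is reflexive.
   Context: A Banach ideal space over $(I,2^I,m)$ is a linear space $E$ of real functions (sequences) on $I$ with a complete norm such that (i) if $|x|\le|y|$ coordinatewise and $y\in E$, then $x\in E$ and $\|x\|_E\le\|y\|_E$; (ii) $E$ contains a strictly positive sequence. For a family $\mathcal X=(X_\alpha)$ of Banach spaces, $E(\mathcal X)=\left(\oplus_{\alpha\in I}X_\alpha\right)_E=\{f=(f_\alpha)_\alpha:f_\alpha\in X_\alpha,\ (\|f_\alpha\|_{X_\alpha})_\alpha\in E\}$ with norm $\|f\|_{E(\mathcal X)}=\left\|(\|f_\alpha\|_{X_\alpha})_\alpha\right\|_E$. $X^*$ denotes the topological dual. A (quasi-)normed lattice $F$ is order continuous if $\|f_n\|_F\to0$ for each sequence in $F$ with $f_n\ge f_{n+1}$ and $\inf_nf_n=0$. When $E$ is order continuous, $E^*$ is identified isometrically with a Banach ideal sequence space (its Köthe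 dual) through $x\mapsto\sum_\alpha x_\alpha y_\alpha$; so $E^*(\mathcal X^* )$ is defined as a direct sum. The identification of $E^*(\mathcal X^* )$ with $E(\mathcal X)^*$ is the natural one, $\langle f,g\rangle=\sum_\alpha g_\alpha(f_\alpha)$ for $g=(g_\alpha)\in E^*(\mathcal X^* )$. *)

theory Defs
  imports "HOL-Analysis.Analysis" "HOL-Algebra.Module"
begin

text \<open>
  The members of a family of Banach spaces, and the duals of a space, need not share a type-class
  structure on one type, so normed spaces are structures with an explicit carrier: modules over
  the reals in the sense of \<^locale>\<open>Module.module\<close> together with a norm.  The fields
  \<^const>\<open>mult\<close> and \<^const>\<open>one\<close> inherited from rings carry no meaning.  Functions whose domain is
  a carrier or an index set are extensional, that is, \<^const>\<open>undefined\<close> outside it.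
\<close>

definition real_field :: "real ring"
  where "real_field = \<lparr>carrier = UNIV, mult = (*), one = 1, zero = 0, add = (+)\<rparr>"

record 'a nspace = "(real, 'a) module" +
  nrm :: "'a \<Rightarrow> real"

locale normed_space = Module.module real_field X
  for X :: "'a nspace" (structure) +
  assumes nrm_eq_0: "x \<in> carrier X \<Longrightarrow> nrm X x = 0 \<longleftrightarrow> x = \<zero>"
    and nrm_triangle: "x \<in> carrier X \<Longrightarrow> y \<in> carrier X \<Longrightarrow> nrm X (x \<oplus> y) \<le> nrm X x + nrm X y"
    and nrm_smult: "x \<in> carrier X \<Longrightarrow> nrm X (a \<odot>\<^bsub>X\<^esub> x) = \<bar>a\<bar> * nrm X x"

text \<open>\<^locale>\<open>Metric_space\<close> requires symmetry and nonnegativity on the whole type, hence the cut-off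
  outside the carrier.\<close>

definition ndist :: "'a nspace \<Rightarrow> 'a \<Rightarrow> 'a \<Rightarrow> real"
  where "ndist X x y =
    (if x \<in> carrier X \<and> y \<in> carrier X then nrm X (x \<ominus>\<^bsub>X\<^esub> y) else 0)"

lemma (in normed_space) Metric_space_ndist: "Metric_space (carrier X) (ndist X)"
proof -
  have carrier_R: "carrier real_field = UNIV"
    by (simp add: real_field_def)
  have neg: "nrm X (\<ominus> x) = nrm X x" if x: "x \<in> carrier X" for x
  proof -
    have "(\<ominus>\<^bsub>real_field\<^esub> \<one>\<^bsub>real_field\<^esub>) \<odot>\<^bsub>X\<^esub> x = \<ominus> x"
      using x smult_l_minus[of "\<one>\<^bsub>real_field\<^esub>" x] by simp
    moreover have "\<ominus>\<^bsub>real_field\<^esub> \<one>\<^bsub>real_field\<^esub> = - 1"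
      by (rule R.minus_equality) (simp_all add: real_field_def)
    ultimately show ?thesis using nrm_smult[OF x, of "- 1"] by simp
  qed
  have ge0: "0 \<le> nrm X x" if x: "x \<in> carrier X" for x
  proof -
    have "0 = nrm X (x \<oplus> \<ominus> x)"
      using x nrm_eq_0[of \<zero>] by (simp add: M.r_neg)
    also have "\<dots> \<le> nrm X x + nrm X x"
      using nrm_triangle[of x "\<ominus> x"] x neg by simp
    finally show ?thesis by simp
  qed
  have comm: "nrm X (x \<ominus> y) = nrm X (y \<ominus> x)" if "x \<in> carrier X" "y \<in> carrier X" for x y
  proof -
    have "y \<ominus> x = \<ominus> (x \<ominus> y)"
      using that by (simp add: M.minus_eq M.minus_add M.a_comm)
    then show ?thesis using neg[of "x \<ominus> y"] that by simp
  qed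
  have tri: "nrm X (x \<ominus> z) \<le> nrm X (x \<ominus> y) + nrm X (y \<ominus> z)"
    if "x \<in> carrier X" "y \<in> carrier X" "z \<in> carrier X" for x y z
  proof -
    have "x \<ominus> z = (x \<ominus> y) \<oplus> (y \<ominus> z)"
      using that by (simp add: M.minus_eq M.a_assoc M.r_neg1)
    then show ?thesis using nrm_triangle[of "x \<ominus> y" "y \<ominus> z"] that by simp
  qed
  have eq: "x \<ominus> y = \<zero> \<longleftrightarrow> x = y" if "x \<in> carrier X" "y \<in> carrier X" for x y
  proof
    assume "x \<ominus> y = \<zero>"
    moreover have "(x \<ominus> y) \<oplus> y = x"
      using that by (simp add: M.minus_eq M.a_assoc M.l_neg)
    ultimately show "x = y" using that by simp
  qed (use that in \<open>simp add: M.minus_eq M.r_neg\<close>)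
  show ?thesis
  proof
    show "0 \<le> ndist X x y" for x y using ge0 by (simp add: ndist_def)
    show "ndist X x y = ndist X y x" for x y using comm by (auto simp: ndist_def)
    show "ndist X x y = 0 \<longleftrightarrow> x = y" if "x \<in> carrier X" "y \<in> carrier X" for x y
      using that nrm_eq_0[of "x \<ominus> y"] eq by (simp add: ndist_def)
    show "ndist X x z \<le> ndist X x y + ndist X y z"
      if "x \<in> carrier X" "y \<in> carrier X" "z \<in> carrier X" for x y z
      using tri that by (simp add: ndist_def)
  qed
qed

locale banach_space = normed_space +
  assumes complete: "Metric_space.mcomplete (carrier X) (ndist X)"

definition bounded_functional :: "'a nspace \<Rightarrow> ('a \<Rightarrow> real) \<Rightarrow> bool"
  where "bounded_functional X \<phi> \<longleftrightarrow>
    (\<forall>x\<in>carrier X. \<forall>y\<in>carrier X. \<phi> (x \<oplus>\<^bsub>X\<^esub> y) = \<phi> x + \<phi> y) \<and>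
    (\<forall>a. \<forall>x\<in>carrier X. \<phi> (a \<odot>\<^bsub>X\<^esub> x) = a * \<phi> x) \<and>
    (\<exists>C. \<forall>x\<in>carrier X. \<bar>\<phi> x\<bar> \<le> C * nrm X x)"

definition dual_space :: "'a nspace \<Rightarrow> ('a \<Rightarrow> real) nspace"
  where "dual_space X =
    \<lparr>carrier = {\<phi> \<in> extensional (carrier X). bounded_functional X \<phi>},
     mult = undefined, one = undefined,
     zero = (\<lambda>x\<in>carrier X. 0),
     add = (\<lambda>\<phi> \<psi>. \<lambda>x\<in>carrier X. \<phi> x + \<psi> x),
     smult = (\<lambda>a \<phi>. \<lambda>x\<in>carrier X. a * \<phi> x),
     nrm = (\<lambda>\<phi>. SUP x\<in>{x \<in> carrier X. nrm X x \<le> 1}. \<bar>\<phi> x\<bar>)\<rparr>"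

definition canonical_embedding :: "'a nspace \<Rightarrow> 'a \<Rightarrow> ('a \<Rightarrow> real) \<Rightarrow> real"
  where "canonical_embedding X x = (\<lambda>\<phi>\<in>carrier (dual_space X). \<phi> x)"

definition reflexive_space :: "'a nspace \<Rightarrow> bool"
  where "reflexive_space X \<longleftrightarrow> normed_space X \<and>
    canonical_embedding X ` carrier X = carrier (dual_space (dual_space X))"

definition isometric_isomorphism :: "'a nspace \<Rightarrow> 'b nspace \<Rightarrow> ('a \<Rightarrow> 'b) \<Rightarrow> bool"
  where "isometric_isomorphism X Y T \<longleftrightarrow>
    bij_betw T (carrier X) (carrier Y) \<and>
    (\<forall>x\<in>carrier X. \<forall>y\<in>carrier X. T (x \<oplus>\<^bsub>X\<^esub> y) = T x \<oplus>\<^bsub>Y\<^esub> T y) \<and>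
    (\<forall>a. \<forall>x\<in>carrier X. T (a \<odot>\<^bsub>X\<^esub> x) = a \<odot>\<^bsub>Y\<^esub> T x) \<and>
    (\<forall>x\<in>carrier X. nrm Y (T x) = nrm X x)"

locale banach_ideal_space = banach_space E
  for I :: "'i set" and E :: "('i \<Rightarrow> real) nspace" (structure) +
  assumes extensional_carrier: "carrier E \<subseteq> extensional I"
    and zero_pointwise: "\<zero> = (\<lambda>\<alpha>\<in>I. 0)"
    and add_pointwise: "x \<in> carrier E \<Longrightarrow> y \<in> carrier E \<Longrightarrow> x \<oplus> y = (\<lambda>\<alpha>\<in>I. x \<alpha> + y \<alpha>)"
    and smult_pointwise: "x \<in> carrier E \<Longrightarrow> a \<odot>\<^bsub>E\<^esub> x = (\<lambda>\<alpha>\<in>I. a * x \<alpha>)"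
    and ideal: "x \<in> extensional I \<Longrightarrow> y \<in> carrier E \<Longrightarrow> (\<And>\<alpha>. \<alpha> \<in> I \<Longrightarrow> \<bar>x \<alpha>\<bar> \<le> \<bar>y \<alpha>\<bar>) \<Longrightarrow>
      x \<in> carrier E \<and> nrm E x \<le> nrm E y"
    and strictly_positive: "\<exists>w\<in>carrier E. \<forall>\<alpha>\<in>I. 0 < w \<alpha>"

definition direct_sum :: "'i set \<Rightarrow> ('i \<Rightarrow> real) nspace \<Rightarrow> ('i \<Rightarrow> 'a nspace) \<Rightarrow> ('i \<Rightarrow> 'a) nspace"
  where "direct_sum I E X =
    \<lparr>carrier = {f \<in> \<Pi>\<^sub>E \<alpha>\<in>I. carrier (X \<alpha>). (\<lambda>\<alpha>\<in>I. nrm (X \<alpha>) (f \<alpha>)) \<in> carrier E},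
     mult = undefined, one = undefined,
     zero = (\<lambda>\<alpha>\<in>I. \<zero>\<^bsub>X \<alpha>\<^esub>),
     add = (\<lambda>f g. \<lambda>\<alpha>\<in>I. f \<alpha> \<oplus>\<^bsub>X \<alpha>\<^esub> g \<alpha>),
     smult = (\<lambda>a f. \<lambda>\<alpha>\<in>I. a \<odot>\<^bsub>X \<alpha>\<^esub> f \<alpha>),
     nrm = (\<lambda>f. nrm E (\<lambda>\<alpha>\<in>I. nrm (X \<alpha>) (f \<alpha>)))\<rparr>"

text \<open>Order continuity of \<open>F\<close> with respect to the order \<open>leq\<close>; the infimum is taken in \<open>F\<close>.\<close>

definition order_continuous :: "'a nspace \<Rightarrow> ('a \<Rightarrow> 'a \<Rightarrow> bool) \<Rightarrow> bool"
  where "order_continuous F leq \<longleftrightarrow>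
    (\<forall>f :: nat \<Rightarrow> 'a.
      (\<forall>n. f n \<in> carrier F) \<and> (\<forall>n. leq (f (Suc n)) (f n)) \<and>
      is_glb \<lparr>carrier = carrier F, eq = (=), le = leq\<rparr> \<zero>\<^bsub>F\<^esub> (range f)
      \<longrightarrow> (\<lambda>n. nrm F (f n)) \<longlonglongrightarrow> 0)"

definition pointwise_le :: "'i set \<Rightarrow> ('i \<Rightarrow> real) \<Rightarrow> ('i \<Rightarrow> real) \<Rightarrow> bool"
  where "pointwise_le I x y \<longleftrightarrow> (\<forall>\<alpha>\<in>I. x \<alpha> \<le> y \<alpha>)"

text \<open>The order of the dual Banach lattice: functionals are compared on the positive cone.\<close>

definition dual_le ::
    "'i set \<Rightarrow> ('i \<Rightarrow> real) nspace \<Rightarrow> (('i \<Rightarrow> real) \<Rightarrow> real) \<Rightarrow> (('i \<Rightarrow> real) \<Rightarrow> real) \<Rightarrow> bool"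
  where "dual_le I E \<phi> \<psi> \<longleftrightarrow>
    (\<forall>x\<in>carrier E. (\<forall>\<alpha>\<in>I. 0 \<le> x \<alpha>) \<longrightarrow> \<phi> x \<le> \<psi> x)"

text \<open>The dual of \<open>E\<close> as a sequence space: a sequence \<open>y\<close> stands for the functional
  \<open>x \<mapsto> \<Sum>\<^sub>\<alpha> x\<^sub>\<alpha> y\<^sub>\<alpha>\<close> and has the norm of that functional.\<close>

definition sequence_functional ::
    "'i set \<Rightarrow> ('i \<Rightarrow> real) nspace \<Rightarrow> ('i \<Rightarrow> real) \<Rightarrow> ('i \<Rightarrow> real) \<Rightarrow> real"
  where "sequence_functional I E y = (\<lambda>x\<in>carrier E. \<Sum>\<^sub>\<infinity>\<alpha>\<in>I. x \<alpha> * y \<alpha>)"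

definition kothe_dual :: "'i set \<Rightarrow> ('i \<Rightarrow> real) nspace \<Rightarrow> ('i \<Rightarrow> real) nspace"
  where "kothe_dual I E =
    \<lparr>carrier = {y \<in> extensional I. (\<forall>x\<in>carrier E. (\<lambda>\<alpha>. x \<alpha> * y \<alpha>) summable_on I) \<and>
       sequence_functional I E y \<in> carrier (dual_space E)},
     mult = undefined, one = undefined,
     zero = (\<lambda>\<alpha>\<in>I. 0),
     add = (\<lambda>x y. \<lambda>\<alpha>\<in>I. x \<alpha> + y \<alpha>),
     smult = (\<lambda>a x. \<lambda>\<alpha>\<in>I. a * x \<alpha>),
     nrm = (\<lambda>y. nrm (dual_space E) (sequence_functional I E y))\<rparr>"

end

theory Submission
  imports Defs
begin

text \<open>
  Both parts compare a family with its truncations to finite sets of indices.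

  \<^bold>\<open>The dual.\<close>  A functional \<open>\<psi>\<close> on the direct sum \<open>D\<close> has components \<open>\<psi>\<^sub>\<alpha>\<close> on the spaces \<open>X\<^sub>\<alpha>\<close>,
  and on a finitely supported family it is the sum of the values of its components.  Choosing in
  \<open>X\<^sub>\<alpha>\<close> a vector of norm at most \<open>\<bar>x\<^sub>\<alpha>\<bar>\<close> on which \<open>\<psi>\<^sub>\<alpha>\<close> nearly takes the value \<open>\<bar>x\<^sub>\<alpha>\<bar> \<parallel>\<psi>\<^sub>\<alpha>\<parallel>\<close> shows that
  the partial sums of \<open>\<Sum>\<^sub>\<alpha> \<bar>x\<^sub>\<alpha>\<bar> \<parallel>\<psi>\<^sub>\<alpha>\<parallel>\<close> are at most \<open>\<parallel>\<psi>\<parallel> \<parallel>x\<parallel>\<close> (\<open>component_norm_estimate\<close>), so the sequence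
  \<open>(\<parallel>\<psi>\<^sub>\<alpha>\<parallel>)\<close> lies in the Koethe dual of \<open>E\<close> and has norm at most \<open>\<parallel>\<psi>\<parallel>\<close>.  Hoelder's inequality gives the
  opposite estimate, so the pairing is isometric.  It is onto because the tails of every family
  tend to zero in norm: this is what order continuity of \<open>E\<close> means along an exhaustion of the
  countable set \<open>I\<close> by finite sets, and it makes \<open>\<psi>\<close> the sum of its components
  (\<open>component_has_sum\<close>).

  \<^bold>\<open>Reflexivity.\<close>  Weak compactness is replaced by a consequence of the Hahn--Banach theorem: for a
  bounded net \<open>x\<^sub>i\<close> in a reflexive space there is a point \<open>z\<close> with \<open>\<phi> z \<le> lim sup \<phi> x\<^sub>i\<close> for all
  functionals \<open>\<phi>\<close>, since the right-hand side is sublinear in \<open>\<phi>\<close> and dominates an element of the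
  bidual (\<open>reflexive_cluster_point\<close>).  In a reflexive Banach ideal space, a coordinate that is
  eventually constant along the net has that value at \<open>z\<close>; so if every coordinate is eventually
  zero, then no functional stays above a positive constant on the net.  Applied to tails this shows that the
  tails of elements of \<open>E\<close> vanish (\<open>reflexive_vanishing_tails\<close>) and that every functional on \<open>D\<close>
  is approximated in norm by functionals of finitely many coordinates
  (\<open>reflexive_dual_tails\<close>).

  Now let \<open>\<Phi>\<close> be in the bidual of \<open>D\<close>.  On functionals of the coordinate \<open>\<alpha>\<close> alone it is evaluation
  at some \<open>x\<^sub>\<alpha>\<close>, by reflexivity of \<open>X\<^sub>\<alpha>\<close>.  Testing \<open>\<Phi>\<close> on norming functionals bounds the truncations
  of \<open>(\<parallel>x\<^sub>\<alpha>\<parallel>)\<close> by \<open>\<parallel>\<Phi>\<parallel>\<close>, and their cluster point in \<open>E\<close> is the sequence \<open>(\<parallel>x\<^sub>\<alpha>\<parallel>)\<close> itself; hence \<open>x\<close>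
  belongs to \<open>D\<close>.  Evaluation at \<open>x\<close> and \<open>\<Phi>\<close> agree on functionals of finitely many coordinates,
  which are dense, and so they are equal.
\<close>

section \<open>The Hahn--Banach theorem for modules over the reals\<close>

lemma real_field_simps [simp]:
  "carrier real_field = UNIV" "\<zero>\<^bsub>real_field\<^esub> = 0" "\<one>\<^bsub>real_field\<^esub> = 1"
  "a \<oplus>\<^bsub>real_field\<^esub> b = a + b" "a \<otimes>\<^bsub>real_field\<^esub> b = a * b"
  by (simp_all add: real_field_def)

lemma cring_real_field: "cring real_field"
proof (intro cringI abelian_groupI comm_monoidI)
  show "\<exists>y\<in>carrier real_field. y \<oplus>\<^bsub>real_field\<^esub> x = \<zero>\<^bsub>real_field\<^esub>" for x
    by (intro bexI[of _ "- x"]) simp_all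
qed (simp_all add: algebra_simps)

text \<open>The additive inverse of \<open>x\<close> is \<open>(- 1) \<odot> x\<close>, so the group axioms come down to these rules.\<close>
lemma normed_spaceI:
  assumes add_closed: "\<And>x y. x \<in> carrier X \<Longrightarrow> y \<in> carrier X \<Longrightarrow> x \<oplus>\<^bsub>X\<^esub> y \<in> carrier X"
    and smult_closed: "\<And>a x. x \<in> carrier X \<Longrightarrow> a \<odot>\<^bsub>X\<^esub> x \<in> carrier X"
    and zero_closed: "\<zero>\<^bsub>X\<^esub> \<in> carrier X"
    and add_assoc: "\<And>x y z. x \<in> carrier X \<Longrightarrow> y \<in> carrier X \<Longrightarrow> z \<in> carrier X \<Longrightarrow>
      (x \<oplus>\<^bsub>X\<^esub> y) \<oplus>\<^bsub>X\<^esub> z = x \<oplus>\<^bsub>X\<^esub> (y \<oplus>\<^bsub>X\<^esub> z)"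
    and add_comm: "\<And>x y. x \<in> carrier X \<Longrightarrow> y \<in> carrier X \<Longrightarrow> x \<oplus>\<^bsub>X\<^esub> y = y \<oplus>\<^bsub>X\<^esub> x"
    and zero_add: "\<And>x. x \<in> carrier X \<Longrightarrow> \<zero>\<^bsub>X\<^esub> \<oplus>\<^bsub>X\<^esub> x = x"
    and neg: "\<And>x. x \<in> carrier X \<Longrightarrow> (- 1) \<odot>\<^bsub>X\<^esub> x \<oplus>\<^bsub>X\<^esub> x = \<zero>\<^bsub>X\<^esub>"
    and smult_l: "\<And>a b x. x \<in> carrier X \<Longrightarrow> (a + b) \<odot>\<^bsub>X\<^esub> x = a \<odot>\<^bsub>X\<^esub> x \<oplus>\<^bsub>X\<^esub> b \<odot>\<^bsub>X\<^esub> x"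
    and smult_r: "\<And>a x y. x \<in> carrier X \<Longrightarrow> y \<in> carrier X \<Longrightarrow>
      a \<odot>\<^bsub>X\<^esub> (x \<oplus>\<^bsub>X\<^esub> y) = a \<odot>\<^bsub>X\<^esub> x \<oplus>\<^bsub>X\<^esub> a \<odot>\<^bsub>X\<^esub> y"
    and smult_assoc: "\<And>a b x. x \<in> carrier X \<Longrightarrow> (a * b) \<odot>\<^bsub>X\<^esub> x = a \<odot>\<^bsub>X\<^esub> (b \<odot>\<^bsub>X\<^esub> x)"
    and smult_one: "\<And>x. x \<in> carrier X \<Longrightarrow> 1 \<odot>\<^bsub>X\<^esub> x = x"
    and nrm_0: "nrm X \<zero>\<^bsub>X\<^esub> = 0"
    and nrm_0D: "\<And>x. x \<in> carrier X \<Longrightarrow> nrm X x = 0 \<Longrightarrow> x = \<zero>\<^bsub>X\<^esub>"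
    and nrm_triangle: "\<And>x y. x \<in> carrier X \<Longrightarrow> y \<in> carrier X \<Longrightarrow> nrm X (x \<oplus>\<^bsub>X\<^esub> y) \<le> nrm X x + nrm X y"
    and nrm_smult: "\<And>a x. x \<in> carrier X \<Longrightarrow> nrm X (a \<odot>\<^bsub>X\<^esub> x) = \<bar>a\<bar> * nrm X x"
  shows "normed_space X"
proof (intro normed_space.intro moduleI cring_real_field abelian_groupI normed_space_axioms.intro)
  show "\<exists>y\<in>carrier X. y \<oplus>\<^bsub>X\<^esub> x = \<zero>\<^bsub>X\<^esub>" if "x \<in> carrier X" for x
    using that by (intro bexI[of _ "(- 1) \<odot>\<^bsub>X\<^esub> x"]) (simp_all add: smult_closed neg)
  show "nrm X x = 0 \<longleftrightarrow> x = \<zero>\<^bsub>X\<^esub>" if "x \<in> carrier X" for x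
    using that nrm_0 nrm_0D by auto
qed (simp_all, (rule assms; assumption)+)

locale real_module = Module.module real_field X for X :: "'a nspace" (structure)

sublocale normed_space \<subseteq> real_module X
  by unfold_locales

definition linear_functional :: "'a nspace \<Rightarrow> ('a \<Rightarrow> real) \<Rightarrow> bool"
  where "linear_functional X \<phi> \<longleftrightarrow>
    (\<forall>x\<in>carrier X. \<forall>y\<in>carrier X. \<phi> (x \<oplus>\<^bsub>X\<^esub> y) = \<phi> x + \<phi> y) \<and>
    (\<forall>a. \<forall>x\<in>carrier X. \<phi> (a \<odot>\<^bsub>X\<^esub> x) = a * \<phi> x)"

definition sublinear :: "'a nspace \<Rightarrow> ('a \<Rightarrow> real) \<Rightarrow> bool"
  where "sublinear X p \<longleftrightarrow>
    (\<forall>x\<in>carrier X. \<forall>y\<in>carrier X. p (x \<oplus>\<^bsub>X\<^esub> y) \<le> p x + p y) \<and>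
    (\<forall>a>0. \<forall>x\<in>carrier X. p (a \<odot>\<^bsub>X\<^esub> x) = a * p x)"

context real_module
begin

lemma scale_zero [simp]: "x \<in> carrier X \<Longrightarrow> 0 \<odot>\<^bsub>X\<^esub> x = \<zero>"
  using smult_l_null by simp

lemma scale_one [simp]: "x \<in> carrier X \<Longrightarrow> 1 \<odot>\<^bsub>X\<^esub> x = x"
  using smult_one by simp

lemma neg_eq_scale: "x \<in> carrier X \<Longrightarrow> \<ominus> x = (- 1) \<odot>\<^bsub>X\<^esub> x"
  using smult_l_distr[of "- 1" 1 x] by (simp add: M.minus_equality)

lemma scale_cancel: "x \<in> carrier X \<Longrightarrow> a \<noteq> 0 \<Longrightarrow> inverse a \<odot>\<^bsub>X\<^esub> (a \<odot>\<^bsub>X\<^esub> x) = x"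
  using smult_assoc1[of "inverse a" a x] by simp

text \<open>Calculation rules free of the ring \<^const>\<open>real_field\<close>.  Collected in one list, they transfer to
  the members of a family, where they are applied to each coordinate.\<close>
lemma real_module_rules:
  "\<zero> \<in> carrier X"
  "x \<in> carrier X \<Longrightarrow> y \<in> carrier X \<Longrightarrow> x \<oplus> y \<in> carrier X"
  "x \<in> carrier X \<Longrightarrow> a \<odot>\<^bsub>X\<^esub> x \<in> carrier X"
  "x \<in> carrier X \<Longrightarrow> y \<in> carrier X \<Longrightarrow> z \<in> carrier X \<Longrightarrow> (x \<oplus> y) \<oplus> z = x \<oplus> (y \<oplus> z)"
  "x \<in> carrier X \<Longrightarrow> y \<in> carrier X \<Longrightarrow> x \<oplus> y = y \<oplus> x"
  "x \<in> carrier X \<Longrightarrow> \<zero> \<oplus> x = x"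
  "x \<in> carrier X \<Longrightarrow> x \<oplus> \<zero> = x"
  "x \<in> carrier X \<Longrightarrow> (- 1) \<odot>\<^bsub>X\<^esub> x \<oplus> x = \<zero>"
  "x \<in> carrier X \<Longrightarrow> (a + b) \<odot>\<^bsub>X\<^esub> x = a \<odot>\<^bsub>X\<^esub> x \<oplus> b \<odot>\<^bsub>X\<^esub> x"
  "x \<in> carrier X \<Longrightarrow> y \<in> carrier X \<Longrightarrow> a \<odot>\<^bsub>X\<^esub> (x \<oplus> y) = a \<odot>\<^bsub>X\<^esub> x \<oplus> a \<odot>\<^bsub>X\<^esub> y"
  "x \<in> carrier X \<Longrightarrow> (a * b) \<odot>\<^bsub>X\<^esub> x = a \<odot>\<^bsub>X\<^esub> (b \<odot>\<^bsub>X\<^esub> x)"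
  "x \<in> carrier X \<Longrightarrow> 1 \<odot>\<^bsub>X\<^esub> x = x"
  "a \<odot>\<^bsub>X\<^esub> \<zero> = \<zero>"
  using smult_l_distr[of a b x] smult_r_distr[of a x y] smult_assoc1[of a b x] M.l_neg[of x]
  by (simp_all add: M.a_ac smult_r_null flip: neg_eq_scale)

lemma sublinearI:
  assumes add: "\<And>x y. x \<in> carrier X \<Longrightarrow> y \<in> carrier X \<Longrightarrow> p (x \<oplus> y) \<le> p x + p y"
    and smult: "\<And>a x. 0 < a \<Longrightarrow> x \<in> carrier X \<Longrightarrow> p (a \<odot>\<^bsub>X\<^esub> x) \<le> a * p x"
  shows "sublinear X p"
proof -
  have "p (a \<odot>\<^bsub>X\<^esub> x) = a * p x" if "0 < a" "x \<in> carrier X" for a x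
  proof (rule antisym)
    have "p x \<le> inverse a * p (a \<odot>\<^bsub>X\<^esub> x)"
      using that smult[of "inverse a" "a \<odot>\<^bsub>X\<^esub> x"] by (simp add: scale_cancel)
    then show "a * p x \<le> p (a \<odot>\<^bsub>X\<^esub> x)" using that by (simp add: field_simps)
  qed (use that smult in simp)
  with add show ?thesis by (simp add: sublinear_def)
qed

lemma sublinear_zero:
  assumes "sublinear X p"
  shows "p \<zero> = 0"
proof -
  have "p ((2::real) \<odot>\<^bsub>X\<^esub> \<zero>) = 2 * p \<zero>"
    using assms unfolding sublinear_def by (meson M.zero_closed zero_less_numeral)
  then show ?thesis using smult_r_null[of 2] by simp
qed

lemma sublinear_lower:
  assumes "sublinear X p" "x \<in> carrier X"
  shows "- p (\<ominus> x) \<le> p x"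
proof -
  have "p (x \<oplus> \<ominus> x) \<le> p x + p (\<ominus> x)" using assms by (simp add: sublinear_def del: M.r_neg)
  then show ?thesis using assms sublinear_zero[of p] by (simp add: M.r_neg)
qed

text \<open>The witness is \<open>q y = inf\<^sub>t\<^sub>\<ge>\<^sub>0 (p (y + t x) - t p x)\<close>.  It tightens \<open>p\<close> in the direction \<open>x\<close>: a
  functional below \<open>q\<close> takes at \<open>x\<close> a value of at least \<open>p x\<close>.\<close>
lemma sublinear_shift:
  assumes p: "sublinear X p" and x: "x \<in> carrier X"
  obtains q where "sublinear X q" "\<And>y. y \<in> carrier X \<Longrightarrow> q y \<le> p y"
    "\<And>y. y \<in> carrier X \<Longrightarrow> q y + p x \<le> p (y \<oplus> x)"
proof -
  define q where "q y = (INF t\<in>{0..}. p (y \<oplus> t \<odot>\<^bsub>X\<^esub> x) - t * p x)" for y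
  have tx: "p (t \<odot>\<^bsub>X\<^esub> x) = t * p x" if "0 \<le> t" for t
    using that p x sublinear_zero[OF p]
    by (cases "t = 0") (auto simp: sublinear_def)
  \<comment> \<open>Subadditivity, applied to \<open>t x = (y + t x) - y\<close>, keeps the infimum finite.\<close>
  have lower: "- p (\<ominus> y) \<le> p (y \<oplus> t \<odot>\<^bsub>X\<^esub> x) - t * p x" if "y \<in> carrier X" "0 \<le> t" for y t
  proof -
    have "p ((y \<oplus> t \<odot>\<^bsub>X\<^esub> x) \<oplus> \<ominus> y) \<le> p (y \<oplus> t \<odot>\<^bsub>X\<^esub> x) + p (\<ominus> y)"
      using p x that by (simp add: sublinear_def)
    moreover have "(y \<oplus> t \<odot>\<^bsub>X\<^esub> x) \<oplus> \<ominus> y = t \<odot>\<^bsub>X\<^esub> x"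
      using that x by (simp add: M.a_ac M.r_neg2)
    ultimately show ?thesis using tx that by simp
  qed
  then have bdd: "bdd_below ((\<lambda>t. p (y \<oplus> t \<odot>\<^bsub>X\<^esub> x) - t * p x) ` {0..})" if "y \<in> carrier X" for y
    using that by (auto intro!: bdd_belowI2)
  have q_le: "q y \<le> p (y \<oplus> t \<odot>\<^bsub>X\<^esub> x) - t * p x" if "y \<in> carrier X" "0 \<le> t" for y t
    unfolding q_def using that bdd by (intro cINF_lower) auto
  have le_q: "c \<le> q y" if "\<And>t. 0 \<le> t \<Longrightarrow> c \<le> p (y \<oplus> t \<odot>\<^bsub>X\<^esub> x) - t * p x" for c y
    unfolding q_def using that by (intro cINF_greatest) auto
  show thesis
  proof
    show "sublinear X q"
    proof (rule sublinearI)
      fix y z assume yz: "y \<in> carrier X" "z \<in> carrier X"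
      have "q (y \<oplus> z) \<le> (p (y \<oplus> s \<odot>\<^bsub>X\<^esub> x) - s * p x) + (p (z \<oplus> t \<odot>\<^bsub>X\<^esub> x) - t * p x)"
        if st: "0 \<le> s" "0 \<le> t" for s t
      proof -
        have "(y \<oplus> z) \<oplus> (s + t) \<odot>\<^bsub>X\<^esub> x = (y \<oplus> s \<odot>\<^bsub>X\<^esub> x) \<oplus> (z \<oplus> t \<odot>\<^bsub>X\<^esub> x)"
          using smult_l_distr[of s t x] x yz by (simp add: M.a_ac)
        then have "q (y \<oplus> z) \<le> p ((y \<oplus> s \<odot>\<^bsub>X\<^esub> x) \<oplus> (z \<oplus> t \<odot>\<^bsub>X\<^esub> x)) - (s + t) * p x"
          using q_le[of "y \<oplus> z" "s + t"] yz st by simp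
        also have "\<dots> \<le> p (y \<oplus> s \<odot>\<^bsub>X\<^esub> x) + p (z \<oplus> t \<odot>\<^bsub>X\<^esub> x) - (s + t) * p x"
          using p x yz by (simp add: sublinear_def)
        finally show ?thesis by (simp add: algebra_simps)
      qed
      then have "q (y \<oplus> z) - (p (z \<oplus> t \<odot>\<^bsub>X\<^esub> x) - t * p x) \<le> q y" if "0 \<le> t" for t
        using that by (intro le_q) (simp add: algebra_simps)
      then have "q (y \<oplus> z) - q y \<le> q z" by (intro le_q) (simp add: algebra_simps)
      then show "q (y \<oplus> z) \<le> q y + q z" by simp
    next
      fix a y assume a: "(0::real) < a" and y: "y \<in> carrier X"
      have "q (a \<odot>\<^bsub>X\<^esub> y) / a \<le> q y"
      proof (rule le_q)
        fix t :: real assume t: "0 \<le> t"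
        have "a \<odot>\<^bsub>X\<^esub> y \<oplus> (a * t) \<odot>\<^bsub>X\<^esub> x = a \<odot>\<^bsub>X\<^esub> (y \<oplus> t \<odot>\<^bsub>X\<^esub> x)"
          using x y smult_r_distr[of a y "t \<odot>\<^bsub>X\<^esub> x"] smult_assoc1[of a t x] by simp
        then have "q (a \<odot>\<^bsub>X\<^esub> y) \<le> a * p (y \<oplus> t \<odot>\<^bsub>X\<^esub> x) - a * t * p x"
          using q_le[of "a \<odot>\<^bsub>X\<^esub> y" "a * t"] p x y a t by (simp add: sublinear_def)
        then show "q (a \<odot>\<^bsub>X\<^esub> y) / a \<le> p (y \<oplus> t \<odot>\<^bsub>X\<^esub> x) - t * p x"
          using a by (simp add: field_simps)
      qed
      then show "q (a \<odot>\<^bsub>X\<^esub> y) \<le> a * q y" using a by (simp add: field_simps)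
    qed
    show "q y \<le> p y" if "y \<in> carrier X" for y
      using q_le[OF that, of 0] x that by simp
    show "q y + p x \<le> p (y \<oplus> x)" if "y \<in> carrier X" for y
      using q_le[OF that, of 1] x that by simp
  qed
qed

text \<open>In a chain any two members have a common lower bound among themselves, which makes the infimum
  subadditive.\<close>
lemma sublinear_INF_chain:
  assumes ne: "C \<noteq> {}" and sub: "\<And>q. q \<in> C \<Longrightarrow> sublinear X q"
    and lower: "\<And>q x. q \<in> C \<Longrightarrow> x \<in> carrier X \<Longrightarrow> b x \<le> q x"
    and chain: "\<And>q r. q \<in> C \<Longrightarrow> r \<in> C \<Longrightarrow>
      (\<forall>x\<in>carrier X. q x \<le> r x) \<or> (\<forall>x\<in>carrier X. r x \<le> q x)"
  shows "sublinear X (\<lambda>x. INF q\<in>C. q x)"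
proof -
  have le: "(INF q\<in>C. q x) \<le> q x" if "q \<in> C" "x \<in> carrier X" for q x
    using that lower by (intro cINF_lower bdd_belowI2[where m="b x"]) auto
  show ?thesis
  proof (rule sublinearI)
    fix x y assume xy: "x \<in> carrier X" "y \<in> carrier X"
    have *: "(INF q\<in>C. q (x \<oplus> y)) \<le> q x + r y" if qr: "q \<in> C" "r \<in> C" for q r
    proof -
      have "\<exists>s\<in>C. s x \<le> q x \<and> s y \<le> r y" using chain[OF qr] qr xy by blast
      then obtain s where s: "s \<in> C" "s x \<le> q x" "s y \<le> r y" by blast
      have "(INF q\<in>C. q (x \<oplus> y)) \<le> s (x \<oplus> y)" using s xy le by simp
      also have "\<dots> \<le> s x + s y" using sub[OF s(1)] xy by (simp add: sublinear_def)
      finally show ?thesis using s by simp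
    qed
    have "(INF q\<in>C. q (x \<oplus> y)) - r y \<le> (INF q\<in>C. q x)" if "r \<in> C" for r
      using ne that * by (intro cINF_greatest) (auto simp: algebra_simps)
    then have "(INF q\<in>C. q (x \<oplus> y)) - (INF q\<in>C. q x) \<le> (INF q\<in>C. q y)"
      using ne by (intro cINF_greatest) (auto simp: algebra_simps)
    then show "(INF q\<in>C. q (x \<oplus> y)) \<le> (INF q\<in>C. q x) + (INF q\<in>C. q y)" by simp
  next
    fix a x assume a: "(0::real) < a" and x: "x \<in> carrier X"
    have "(INF q\<in>C. q (a \<odot>\<^bsub>X\<^esub> x)) / a \<le> (INF q\<in>C. q x)"
    proof (rule cINF_greatest[OF ne])
      fix q assume q: "q \<in> C"
      then show "(INF q\<in>C. q (a \<odot>\<^bsub>X\<^esub> x)) / a \<le> q x"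
        using le[OF q, of "a \<odot>\<^bsub>X\<^esub> x"] sub[OF q] a x by (simp add: sublinear_def field_simps)
    qed
    then show "(INF q\<in>C. q (a \<odot>\<^bsub>X\<^esub> x)) \<le> a * (INF q\<in>C. q x)" using a by (simp add: field_simps)
  qed
qed

text \<open>Zorn's lemma, for the reverse pointwise order.  All sublinear functionals below \<open>p\<close> are bounded
  below by \<open>x \<mapsto> - p (- x)\<close>, so the infimum of a chain exists.  Functions are taken extensional to
  make the order antisymmetric.\<close>
lemma minimal_sublinear:
  assumes p: "sublinear X p"
  obtains q where "sublinear X q" "\<And>x. x \<in> carrier X \<Longrightarrow> q x \<le> p x"
    "\<And>r x. sublinear X r \<Longrightarrow> (\<And>x. x \<in> carrier X \<Longrightarrow> r x \<le> q x) \<Longrightarrow> x \<in> carrier X \<Longrightarrow> r x = q x"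
proof -
  define S where "S = {q \<in> extensional (carrier X). sublinear X q \<and> (\<forall>x\<in>carrier X. q x \<le> p x)}"
  let ?P = "\<lambda>q r. \<forall>x\<in>carrier X. r x \<le> q x"
  have restr: "restrict q (carrier X) \<in> S" if "sublinear X q" "\<And>x. x \<in> carrier X \<Longrightarrow> q x \<le> p x" for q
    using that by (simp add: S_def sublinear_def)
  have lower: "- p (\<ominus> x) \<le> q x" if "q \<in> S" "x \<in> carrier X" for q x
  proof -
    have "- q (\<ominus> x) \<le> q x" "q (\<ominus> x) \<le> p (\<ominus> x)"
      using that sublinear_lower[of q x] by (auto simp: S_def)
    then show ?thesis by simp
  qed
  have "\<exists>m\<in>S. \<forall>a\<in>S. ?P m a \<longrightarrow> a = m"
  proof (rule predicate_Zorn)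
    show "partial_order_on S (relation_of ?P S)"
    proof (rule partial_order_on_relation_ofI)
      show "a = b" if "a \<in> S" "b \<in> S" "?P a b" "?P b a" for a b
        using that by (intro extensionalityI[of a "carrier X"] antisym) (auto simp: S_def)
    qed (auto intro: order_trans)
  next
    fix C assume "C \<in> Chains (relation_of ?P S)"
    then have C: "C \<subseteq> S" "\<And>q r. q \<in> C \<Longrightarrow> r \<in> C \<Longrightarrow> ?P q r \<or> ?P r q"
      by (auto simp: Chains_def relation_of_def)
    show "\<exists>u\<in>S. \<forall>a\<in>C. ?P a u"
    proof (cases "C = {}")
      case True
      then show ?thesis using restr[OF p] by auto
    next
      case False
      let ?u = "\<lambda>x. INF q\<in>C. q x"
      have le: "?u x \<le> q x" if "q \<in> C" "x \<in> carrier X" for q x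
        using that lower C(1) by (intro cINF_lower bdd_belowI2[where m="- p (\<ominus> x)"]) auto
      have "sublinear X ?u"
        by (rule sublinear_INF_chain[where b="\<lambda>x. - p (\<ominus> x)", OF False])
          (use C lower in \<open>auto simp: S_def\<close>)
      moreover have "?u x \<le> p x" if "x \<in> carrier X" for x
      proof -
        obtain q where "q \<in> C" using False by blast
        moreover have "q x \<le> p x" using \<open>q \<in> C\<close> C(1) that by (auto simp: S_def)
        ultimately show ?thesis using le that by (meson order_trans)
      qed
      ultimately have "restrict ?u (carrier X) \<in> S" by (rule restr)
      then show ?thesis using le by (intro bexI[of _ "restrict ?u (carrier X)"]) auto
    qed
  qed
  then obtain m where m: "m \<in> S" "\<And>a. a \<in> S \<Longrightarrow> ?P m a \<Longrightarrow> a = m" by blast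
  show thesis
  proof
    show "sublinear X m" "\<And>x. x \<in> carrier X \<Longrightarrow> m x \<le> p x" using m by (auto simp: S_def)
    fix r x assume r: "sublinear X r" "\<And>x. x \<in> carrier X \<Longrightarrow> r x \<le> m x" and x: "x \<in> carrier X"
    have "restrict r (carrier X) \<in> S"
      by (rule restr[OF r(1)]) (use r(2) m(1) in \<open>auto simp: S_def intro: order_trans\<close>)
    then have "restrict r (carrier X) = m" using r(2) by (intro m(2)) auto
    then show "r x = m x" using x by (metis restrict_apply')
  qed
qed

text \<open>A minimal sublinear functional \<open>q\<close> is linear: shifting \<open>q\<close> in the direction \<open>y\<close> cannot make it
  smaller, hence \<open>q x + q y \<le> q (x + y)\<close>.\<close>
lemma dominated_linear_functional:
  assumes "sublinear X p"
  obtains \<phi> where "linear_functional X \<phi>" "\<And>x. x \<in> carrier X \<Longrightarrow> \<phi> x \<le> p x"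
proof -
  obtain q where q: "sublinear X q" "\<And>x. x \<in> carrier X \<Longrightarrow> q x \<le> p x"
    and min: "\<And>r x. sublinear X r \<Longrightarrow> (\<And>x. x \<in> carrier X \<Longrightarrow> r x \<le> q x) \<Longrightarrow> x \<in> carrier X \<Longrightarrow> r x = q x"
    using minimal_sublinear[OF assms] by blast
  have add: "q (x \<oplus> y) = q x + q y" if xy: "x \<in> carrier X" "y \<in> carrier X" for x y
  proof -
    obtain r where r: "sublinear X r" "\<And>z. z \<in> carrier X \<Longrightarrow> r z \<le> q z"
      "\<And>z. z \<in> carrier X \<Longrightarrow> r z + q y \<le> q (z \<oplus> y)"
      using sublinear_shift[OF q(1) xy(2)] by metis
    have "r x = q x" using min r xy by blast
    then have "q x + q y \<le> q (x \<oplus> y)" using r(3)[OF xy(1)] by simp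
    moreover have "q (x \<oplus> y) \<le> q x + q y" using q xy by (simp add: sublinear_def)
    ultimately show ?thesis by simp
  qed
  have neg: "q ((- 1) \<odot>\<^bsub>X\<^esub> x) = - q x" if "x \<in> carrier X" for x
    using add[of x "\<ominus> x"] that sublinear_zero[OF q(1)] by (simp add: M.r_neg flip: neg_eq_scale)
  have "q (a \<odot>\<^bsub>X\<^esub> x) = a * q x" if x: "x \<in> carrier X" for a x
  proof (cases "0 < a" "a = 0" rule: bool.exhaust[case_product bool.exhaust])
    case True_True then show ?thesis by simp
  next
    case True_False then show ?thesis using q x by (simp add: sublinear_def)
  next
    case False_True then show ?thesis using x sublinear_zero[OF q(1)] by simp
  next
    case False_False
    have "a \<odot>\<^bsub>X\<^esub> x = (- a) \<odot>\<^bsub>X\<^esub> ((- 1) \<odot>\<^bsub>X\<^esub> x)"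
      using x smult_assoc1[of "- a" "- 1" x] by simp
    also have "q \<dots> = (- a) * q ((- 1) \<odot>\<^bsub>X\<^esub> x)"
      using False_False q x by (simp add: sublinear_def)
    finally show ?thesis using neg x by simp
  qed
  then have "linear_functional X q" using add by (simp add: linear_functional_def)
  then show thesis using q(2) that by blast
qed

text \<open>Shifting \<open>p\<close> in the direction \<open>x\<close> before taking a dominated functional forces equality at
  \<open>x\<close>.\<close>
theorem hahn_banach:
  assumes p: "sublinear X p" and x: "x \<in> carrier X"
  obtains \<phi> where "linear_functional X \<phi>" "\<And>y. y \<in> carrier X \<Longrightarrow> \<phi> y \<le> p y" "\<phi> x = p x"
proof -
  obtain q where q: "sublinear X q" "\<And>y. y \<in> carrier X \<Longrightarrow> q y \<le> p y"
    "\<And>y. y \<in> carrier X \<Longrightarrow> q y + p x \<le> p (y \<oplus> x)"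
    using sublinear_shift[OF p x] by metis
  obtain \<phi> where \<phi>: "linear_functional X \<phi>" "\<And>y. y \<in> carrier X \<Longrightarrow> \<phi> y \<le> q y"
    using dominated_linear_functional[OF q(1)] by blast
  have le: "\<phi> y \<le> p y" if "y \<in> carrier X" for y using \<phi>(2) q(2) that by (meson order_trans)
  have "\<phi> (\<ominus> x) = - \<phi> x"
    using \<phi>(1) x by (simp add: linear_functional_def neg_eq_scale)
  moreover have "q (\<ominus> x) + p x \<le> 0"
    using q(3)[of "\<ominus> x"] x sublinear_zero[OF p] by (simp add: M.l_neg)
  ultimately have "p x \<le> \<phi> x" using \<phi>(2)[of "\<ominus> x"] x by simp
  with le[OF x] have "\<phi> x = p x" by simp
  with le \<phi>(1) show thesis using that by blast
qed

end

section \<open>Dual spaces and reflexivity\<close>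

context normed_space
begin

lemma nrm_zero [simp]: "nrm X \<zero> = 0"
  using nrm_eq_0 by simp

lemma nrm_neg: "x \<in> carrier X \<Longrightarrow> nrm X (\<ominus> x) = nrm X x"
  using nrm_smult[of x "- 1"] by (simp add: neg_eq_scale)

lemma nrm_nonneg: "x \<in> carrier X \<Longrightarrow> 0 \<le> nrm X x"
  using nrm_triangle[of x "\<ominus> x"] by (simp add: nrm_neg M.r_neg)

lemma sublinear_nrm: "sublinear X (nrm X)"
  by (simp add: sublinear_def nrm_triangle nrm_smult)

lemma bounded_functional_iff:
  "bounded_functional X \<phi> \<longleftrightarrow>
    linear_functional X \<phi> \<and> (\<exists>C. \<forall>x\<in>carrier X. \<bar>\<phi> x\<bar> \<le> C * nrm X x)"
  by (simp add: bounded_functional_def linear_functional_def)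

lemma linear_neg: "linear_functional X \<phi> \<Longrightarrow> x \<in> carrier X \<Longrightarrow> \<phi> (\<ominus> x) = - \<phi> x"
  by (simp add: linear_functional_def neg_eq_scale)

lemma linear_zero: "linear_functional X \<phi> \<Longrightarrow> \<phi> \<zero> = 0"
  using scale_zero[of \<zero>] unfolding linear_functional_def
  by (metis M.zero_closed mult_zero_left)

text \<open>For linear functionals a one-sided bound suffices: the other side is the bound at \<open>- x\<close>.\<close>
lemma linear_abs_le:
  assumes "linear_functional X \<phi>" "\<And>x. x \<in> carrier X \<Longrightarrow> \<phi> x \<le> C * nrm X x" "x \<in> carrier X"
  shows "\<bar>\<phi> x\<bar> \<le> C * nrm X x"
  using assms(2)[of x] assms(2)[of "\<ominus> x"] assms(1,3) by (simp add: linear_neg nrm_neg abs_le_iff)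

lemma dual_memI:
  assumes \<phi>: "linear_functional X \<phi>" and bound: "\<And>x. x \<in> carrier X \<Longrightarrow> \<phi> x \<le> C * nrm X x"
  shows "restrict \<phi> (carrier X) \<in> carrier (dual_space X)"
proof -
  have "linear_functional X (restrict \<phi> (carrier X))"
    using \<phi> by (simp add: linear_functional_def)
  moreover have "\<forall>x\<in>carrier X. \<bar>restrict \<phi> (carrier X) x\<bar> \<le> C * nrm X x"
    using linear_abs_le[OF \<phi> bound] by simp
  ultimately show ?thesis by (auto simp: dual_space_def bounded_functional_iff)
qed

lemma dual_linear: "\<phi> \<in> carrier (dual_space X) \<Longrightarrow> linear_functional X \<phi>"
  by (simp add: dual_space_def bounded_functional_iff)

lemma dual_extensional: "\<phi> \<in> carrier (dual_space X) \<Longrightarrow> \<phi> \<in> extensional (carrier X)"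
  by (simp add: dual_space_def)

lemma dual_add: "\<phi> \<in> carrier (dual_space X) \<Longrightarrow> x \<in> carrier X \<Longrightarrow> y \<in> carrier X \<Longrightarrow>
    \<phi> (x \<oplus> y) = \<phi> x + \<phi> y"
  using dual_linear by (simp add: linear_functional_def)

lemma dual_smult: "\<phi> \<in> carrier (dual_space X) \<Longrightarrow> x \<in> carrier X \<Longrightarrow> \<phi> (a \<odot>\<^bsub>X\<^esub> x) = a * \<phi> x"
  using dual_linear by (simp add: linear_functional_def)

lemma dual_norm_le:
  assumes "\<And>x. x \<in> carrier X \<Longrightarrow> \<phi> x \<le> C * nrm X x" and "0 \<le> C" and "linear_functional X \<phi>"
  shows "nrm (dual_space X) \<phi> \<le> C"
proof -
  have "\<bar>\<phi> x\<bar> \<le> C" if "x \<in> carrier X" "nrm X x \<le> 1" for x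
  proof -
    have "\<bar>\<phi> x\<bar> \<le> C * nrm X x" using linear_abs_le assms that by blast
    also have "\<dots> \<le> C" using that assms(2) nrm_nonneg mult_left_le by blast
    finally show ?thesis .
  qed
  moreover have "\<zero> \<in> {x \<in> carrier X. nrm X x \<le> 1}" by simp
  ultimately have "(SUP x\<in>{x \<in> carrier X. nrm X x \<le> 1}. \<bar>\<phi> x\<bar>) \<le> C"
    by (intro cSUP_least) auto
  then show ?thesis by (simp add: dual_space_def)
qed

lemma bdd_above_unit_ball:
  assumes "\<phi> \<in> carrier (dual_space X)"
  shows "bdd_above ((\<lambda>x. \<bar>\<phi> x\<bar>) ` {x \<in> carrier X. nrm X x \<le> 1})"
proof -
  obtain C where C: "\<And>x. x \<in> carrier X \<Longrightarrow> \<bar>\<phi> x\<bar> \<le> C * nrm X x"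
    using assms unfolding dual_space_def bounded_functional_def by simp blast
  have "\<bar>\<phi> x\<bar> \<le> \<bar>C\<bar>" if "x \<in> carrier X" "nrm X x \<le> 1" for x
  proof -
    have "\<bar>\<phi> x\<bar> \<le> \<bar>C\<bar> * nrm X x"
      using C[OF that(1)] nrm_nonneg[OF that(1)] by (meson abs_ge_self mult_right_mono order_trans)
    also have "\<dots> \<le> \<bar>C\<bar>" using that nrm_nonneg mult_left_le abs_ge_zero by blast
    finally show ?thesis .
  qed
  then show ?thesis by (intro bdd_aboveI2[where M="\<bar>C\<bar>"]) auto
qed

lemma dual_abs_le_nrm:
  assumes "\<phi> \<in> carrier (dual_space X)" "x \<in> carrier X" "nrm X x \<le> 1"
  shows "\<bar>\<phi> x\<bar> \<le> nrm (dual_space X) \<phi>"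
  using cSUP_upper[OF _ bdd_above_unit_ball[OF assms(1)], of x] assms
  by (simp add: dual_space_def)

lemma dual_nrm_nonneg: "\<phi> \<in> carrier (dual_space X) \<Longrightarrow> 0 \<le> nrm (dual_space X) \<phi>"
  using dual_abs_le_nrm[of \<phi> \<zero>] by simp

lemma dual_abs_le:
  assumes \<phi>: "\<phi> \<in> carrier (dual_space X)" and x: "x \<in> carrier X"
  shows "\<bar>\<phi> x\<bar> \<le> nrm (dual_space X) \<phi> * nrm X x"
proof (cases "x = \<zero>")
  case True
  then show ?thesis using linear_zero dual_linear[OF \<phi>] by simp
next
  case False
  then have pos: "0 < nrm X x" using nrm_nonneg[OF x] nrm_eq_0[OF x] by simp
  have "\<bar>\<phi> (inverse (nrm X x) \<odot>\<^bsub>X\<^esub> x)\<bar> \<le> nrm (dual_space X) \<phi>"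
    using pos x by (intro dual_abs_le_nrm[OF \<phi>]) (simp_all add: nrm_smult)
  then show ?thesis using pos by (simp add: dual_smult[OF \<phi> x] abs_mult field_simps)
qed

lemma dual_le: "\<phi> \<in> carrier (dual_space X) \<Longrightarrow> x \<in> carrier X \<Longrightarrow>
    \<phi> x \<le> nrm (dual_space X) \<phi> * nrm X x"
  using dual_abs_le by fastforce

text \<open>The supremum defining the dual norm need not be attained; the factor \<open>r\<close> is the price for a
  witness \<open>v\<close> of norm at most \<open>t\<close>.\<close>
lemma dual_nearly_attained:
  assumes \<phi>: "\<phi> \<in> carrier (dual_space X)" and r: "0 < r" "r < 1" and t: "0 \<le> t"
  obtains v where "v \<in> carrier X" "nrm X v \<le> t" "r * t * nrm (dual_space X) \<phi> \<le> \<phi> v"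
proof (cases "nrm (dual_space X) \<phi> = 0")
  case True
  then show ?thesis using that[of \<zero>] t linear_zero[OF dual_linear[OF \<phi>]] by simp
next
  case False
  then have "0 < nrm (dual_space X) \<phi>" using dual_nrm_nonneg[OF \<phi>] by simp
  then have "r * nrm (dual_space X) \<phi> < nrm (dual_space X) \<phi>" using r by simp
  also have "nrm (dual_space X) \<phi> = (SUP x\<in>{x \<in> carrier X. nrm X x \<le> 1}. \<bar>\<phi> x\<bar>)"
    by (simp add: dual_space_def)
  finally have "r * nrm (dual_space X) \<phi> < (SUP x\<in>{x \<in> carrier X. nrm X x \<le> 1}. \<bar>\<phi> x\<bar>)" .
  moreover have "\<zero> \<in> {x \<in> carrier X. nrm X x \<le> 1}" by simp
  ultimately obtain w where w: "w \<in> carrier X" "nrm X w \<le> 1" "r * nrm (dual_space X) \<phi> < \<bar>\<phi> w\<bar>"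
    using less_cSUP_iff[OF _ bdd_above_unit_ball[OF \<phi>]] by (metis (no_types, lifting) empty_iff mem_Collect_eq)
  let ?v = "(t * sgn (\<phi> w)) \<odot>\<^bsub>X\<^esub> w"
  have "nrm X ?v \<le> t"
  proof -
    have "nrm X ?v = t * (\<bar>sgn (\<phi> w)\<bar> * nrm X w)" using t w by (simp add: nrm_smult abs_mult)
    also have "\<dots> \<le> t"
      using t w(2) nrm_nonneg[OF w(1)] by (intro mult_left_le) (auto simp: sgn_if)
    finally show ?thesis .
  qed
  moreover have "\<phi> ?v = t * \<bar>\<phi> w\<bar>"
    using w by (simp add: dual_smult[OF \<phi>] mult.assoc sgn_mult_self_eq abs_sgn mult.commute)
  moreover have "t * (r * nrm (dual_space X) \<phi>) \<le> t * \<bar>\<phi> w\<bar>"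
    using w(3) t by (intro mult_left_mono) auto
  ultimately show ?thesis using w(1) by (intro that[of ?v]) (simp_all add: mult.left_commute)
qed

lemma normed_space_dual: "normed_space (dual_space X)"
proof (rule normed_spaceI)
  let ?D = "dual_space X"
  have ext: "\<phi> = \<psi>" if "\<phi> \<in> carrier ?D" "\<psi> \<in> carrier ?D" "\<And>x. x \<in> carrier X \<Longrightarrow> \<phi> x = \<psi> x" for \<phi> \<psi>
    using that dual_extensional by (metis extensionalityI)
  have lin: "\<phi> (x \<oplus> y) = \<phi> x + \<phi> y" "\<phi> (a \<odot>\<^bsub>X\<^esub> x) = a * \<phi> x"
    if "\<phi> \<in> carrier ?D" "x \<in> carrier X" "y \<in> carrier X" for \<phi> x y a
    using that dual_add dual_smult by auto
  have le: "\<phi> x \<le> nrm ?D \<phi> * nrm X x" if "\<phi> \<in> carrier ?D" "x \<in> carrier X" for \<phi> x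
    using dual_le that .
  show add: "\<phi> \<oplus>\<^bsub>?D\<^esub> \<psi> \<in> carrier ?D" if \<phi>\<psi>: "\<phi> \<in> carrier ?D" "\<psi> \<in> carrier ?D" for \<phi> \<psi>
  proof -
    have "restrict (\<lambda>x. \<phi> x + \<psi> x) (carrier X) \<in> carrier ?D"
      using le[OF \<phi>\<psi>(1)] le[OF \<phi>\<psi>(2)] lin[OF \<phi>\<psi>(1)] lin[OF \<phi>\<psi>(2)]
      by (intro dual_memI[where C="nrm ?D \<phi> + nrm ?D \<psi>"])
        (auto simp: linear_functional_def algebra_simps intro: add_mono)
    then show ?thesis by (simp add: dual_space_def)
  qed
  show smult: "a \<odot>\<^bsub>?D\<^esub> \<phi> \<in> carrier ?D" if \<phi>: "\<phi> \<in> carrier ?D" for a \<phi>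
  proof -
    have "a * \<phi> x \<le> \<bar>a\<bar> * nrm ?D \<phi> * nrm X x" if "x \<in> carrier X" for x
    proof -
      have "a * \<phi> x \<le> \<bar>a\<bar> * \<bar>\<phi> x\<bar>" by (simp flip: abs_mult)
      also have "\<dots> \<le> \<bar>a\<bar> * (nrm ?D \<phi> * nrm X x)"
        using dual_abs_le[OF \<phi> that] by (intro mult_left_mono) auto
      finally show ?thesis by (simp add: mult.assoc)
    qed
    then have "restrict (\<lambda>x. a * \<phi> x) (carrier X) \<in> carrier ?D"
      using lin[OF \<phi>] by (intro dual_memI[where C="\<bar>a\<bar> * nrm ?D \<phi>"])
        (auto simp: linear_functional_def algebra_simps)
    then show ?thesis by (simp add: dual_space_def)
  qed
  show zero: "\<zero>\<^bsub>?D\<^esub> \<in> carrier ?D"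
    using dual_memI[of "\<lambda>x. 0" 0] by (simp add: dual_space_def linear_functional_def)
  have val: "(\<phi> \<oplus>\<^bsub>?D\<^esub> \<psi>) x = \<phi> x + \<psi> x" "(a \<odot>\<^bsub>?D\<^esub> \<phi>) x = a * \<phi> x" "\<zero>\<^bsub>?D\<^esub> x = 0"
    if "x \<in> carrier X" for \<phi> \<psi> a x
    using that by (auto simp: dual_space_def)
  show "\<phi> \<oplus>\<^bsub>?D\<^esub> \<psi> \<oplus>\<^bsub>?D\<^esub> \<eta> = \<phi> \<oplus>\<^bsub>?D\<^esub> (\<psi> \<oplus>\<^bsub>?D\<^esub> \<eta>)"
    if "\<phi> \<in> carrier ?D" "\<psi> \<in> carrier ?D" "\<eta> \<in> carrier ?D" for \<phi> \<psi> \<eta>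
    using that by (intro ext add) (auto simp: val)
  show "\<phi> \<oplus>\<^bsub>?D\<^esub> \<psi> = \<psi> \<oplus>\<^bsub>?D\<^esub> \<phi>" if "\<phi> \<in> carrier ?D" "\<psi> \<in> carrier ?D" for \<phi> \<psi>
    using that by (intro ext add) (auto simp: val)
  show "\<zero>\<^bsub>?D\<^esub> \<oplus>\<^bsub>?D\<^esub> \<phi> = \<phi>" if "\<phi> \<in> carrier ?D" for \<phi>
    using that zero by (intro ext add) (auto simp: val)
  show "(- 1) \<odot>\<^bsub>?D\<^esub> \<phi> \<oplus>\<^bsub>?D\<^esub> \<phi> = \<zero>\<^bsub>?D\<^esub>" if "\<phi> \<in> carrier ?D" for \<phi>
    using that zero smult by (intro ext add) (auto simp: val)
  show "(a + b) \<odot>\<^bsub>?D\<^esub> \<phi> = a \<odot>\<^bsub>?D\<^esub> \<phi> \<oplus>\<^bsub>?D\<^esub> b \<odot>\<^bsub>?D\<^esub> \<phi>" if "\<phi> \<in> carrier ?D" for a b \<phi>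
    using that by (intro ext add smult) (auto simp: val algebra_simps)
  show "a \<odot>\<^bsub>?D\<^esub> (\<phi> \<oplus>\<^bsub>?D\<^esub> \<psi>) = a \<odot>\<^bsub>?D\<^esub> \<phi> \<oplus>\<^bsub>?D\<^esub> a \<odot>\<^bsub>?D\<^esub> \<psi>"
    if "\<phi> \<in> carrier ?D" "\<psi> \<in> carrier ?D" for a \<phi> \<psi>
    using that by (intro ext add smult) (auto simp: val algebra_simps)
  show "(a * b) \<odot>\<^bsub>?D\<^esub> \<phi> = a \<odot>\<^bsub>?D\<^esub> (b \<odot>\<^bsub>?D\<^esub> \<phi>)" if "\<phi> \<in> carrier ?D" for a b \<phi>
    using that by (intro ext smult) (auto simp: val)
  show "1 \<odot>\<^bsub>?D\<^esub> \<phi> = \<phi>" if "\<phi> \<in> carrier ?D" for \<phi>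
    using that by (intro ext smult) (auto simp: val)
  show "nrm ?D \<zero>\<^bsub>?D\<^esub> = 0"
    using dual_norm_le[of "\<zero>\<^bsub>?D\<^esub>" 0] dual_nrm_nonneg[OF zero] dual_linear[OF zero] by (simp add: val)
  show "\<phi> = \<zero>\<^bsub>?D\<^esub>" if "\<phi> \<in> carrier ?D" "nrm ?D \<phi> = 0" for \<phi>
    using that zero dual_abs_le[OF that(1)] by (intro ext) (auto simp: val)
  show "nrm ?D (\<phi> \<oplus>\<^bsub>?D\<^esub> \<psi>) \<le> nrm ?D \<phi> + nrm ?D \<psi>"
    if \<phi>\<psi>: "\<phi> \<in> carrier ?D" "\<psi> \<in> carrier ?D" for \<phi> \<psi>
    using le[OF \<phi>\<psi>(1)] le[OF \<phi>\<psi>(2)] dual_nrm_nonneg \<phi>\<psi> dual_linear[OF add[OF \<phi>\<psi>]]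
    by (intro dual_norm_le) (auto simp: val algebra_simps intro: add_mono)
  have smult_le: "nrm ?D (a \<odot>\<^bsub>?D\<^esub> \<phi>) \<le> \<bar>a\<bar> * nrm ?D \<phi>" if \<phi>: "\<phi> \<in> carrier ?D" for a \<phi>
  proof (rule dual_norm_le)
    fix x assume x: "x \<in> carrier X"
    have "a * \<phi> x \<le> \<bar>a\<bar> * \<bar>\<phi> x\<bar>" by (simp flip: abs_mult)
    also have "\<dots> \<le> \<bar>a\<bar> * (nrm ?D \<phi> * nrm X x)"
      using dual_abs_le[OF \<phi> x] by (intro mult_left_mono) auto
    finally show "(a \<odot>\<^bsub>?D\<^esub> \<phi>) x \<le> \<bar>a\<bar> * nrm ?D \<phi> * nrm X x" using x by (simp add: val mult.assoc)
  qed (use \<phi> dual_nrm_nonneg dual_linear smult in auto)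
  show "nrm ?D (a \<odot>\<^bsub>?D\<^esub> \<phi>) = \<bar>a\<bar> * nrm ?D \<phi>" if \<phi>: "\<phi> \<in> carrier ?D" for a \<phi>
  proof (cases "a = 0")
    case True
    then show ?thesis
      using smult_le[OF \<phi>, of 0] dual_nrm_nonneg[OF smult[OF \<phi>, of 0]] by simp
  next
    case False
    have "inverse a \<odot>\<^bsub>?D\<^esub> (a \<odot>\<^bsub>?D\<^esub> \<phi>) = \<phi>"
      using \<phi> smult False by (intro ext) (auto simp: val)
    then have "nrm ?D \<phi> \<le> inverse \<bar>a\<bar> * nrm ?D (a \<odot>\<^bsub>?D\<^esub> \<phi>)"
      using smult_le[OF smult[OF \<phi>, of a], of "inverse a"] by simp
    then have "\<bar>a\<bar> * nrm ?D \<phi> \<le> nrm ?D (a \<odot>\<^bsub>?D\<^esub> \<phi>)" using False by (simp add: field_simps)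
    then show ?thesis using smult_le[OF \<phi>, of a] by simp
  qed
qed

lemma norming_functional:
  assumes x: "x \<in> carrier X"
  obtains \<phi> where "\<phi> \<in> carrier (dual_space X)" "\<And>y. y \<in> carrier X \<Longrightarrow> \<bar>\<phi> y\<bar> \<le> nrm X y"
    "\<phi> x = nrm X x"
proof -
  obtain \<phi> where \<phi>: "linear_functional X \<phi>" "\<And>y. y \<in> carrier X \<Longrightarrow> \<phi> y \<le> nrm X y" "\<phi> x = nrm X x"
    using hahn_banach[OF sublinear_nrm x] by blast
  show thesis
  proof (rule that)
    show "restrict \<phi> (carrier X) \<in> carrier (dual_space X)"
      using \<phi> by (intro dual_memI[where C=1]) auto
    show "\<bar>restrict \<phi> (carrier X) y\<bar> \<le> nrm X y" if "y \<in> carrier X" for y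
      using linear_abs_le[OF \<phi>(1), of 1 y] \<phi>(2) that by simp
    show "restrict \<phi> (carrier X) x = nrm X x" using \<phi>(3) x by simp
  qed
qed

text \<open>Reflexivity for functionals on the dual space that are given without a prescribed value outside
  its carrier.\<close>
lemma reflexive_bidual:
  assumes "reflexive_space X" and lin: "linear_functional (dual_space X) \<Phi>"
    and bound: "\<And>\<phi>. \<phi> \<in> carrier (dual_space X) \<Longrightarrow> \<Phi> \<phi> \<le> C * nrm (dual_space X) \<phi>"
  obtains x where "x \<in> carrier X" "\<And>\<phi>. \<phi> \<in> carrier (dual_space X) \<Longrightarrow> \<Phi> \<phi> = \<phi> x"
proof -
  interpret Dual: normed_space "dual_space X" by (rule normed_space_dual)
  have "restrict \<Phi> (carrier (dual_space X)) \<in> canonical_embedding X ` carrier X"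
    using Dual.dual_memI[OF lin bound] assms(1) by (simp add: reflexive_space_def)
  then obtain x where x: "x \<in> carrier X" "restrict \<Phi> (carrier (dual_space X)) = canonical_embedding X x"
    by blast
  have "\<Phi> \<phi> = \<phi> x" if "\<phi> \<in> carrier (dual_space X)" for \<phi>
    using fun_cong[OF x(2), of \<phi>] that by (simp add: canonical_embedding_def)
  with x(1) show thesis by (rule that)
qed

text \<open>Evaluations are always elements of the bidual, so only surjectivity of the canonical embedding
  has to be checked.\<close>
lemma reflexiveI:
  assumes "\<And>\<Phi>. \<Phi> \<in> carrier (dual_space (dual_space X)) \<Longrightarrow>
    \<exists>x\<in>carrier X. \<forall>\<phi>\<in>carrier (dual_space X). \<Phi> \<phi> = \<phi> x"
  shows "reflexive_space X"
proof -
  let ?D = "dual_space X"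
  interpret Dual: normed_space ?D by (rule normed_space_dual)
  have "canonical_embedding X x \<in> carrier (dual_space ?D)" if x: "x \<in> carrier X" for x
    unfolding canonical_embedding_def
  proof (rule Dual.dual_memI)
    show "linear_functional ?D (\<lambda>\<phi>. \<phi> x)"
      using x by (simp add: linear_functional_def dual_space_def)
    show "\<phi> x \<le> nrm X x * nrm ?D \<phi>" if "\<phi> \<in> carrier ?D" for \<phi>
      using dual_le[OF that x] by (simp add: mult.commute)
  qed
  moreover have "\<Phi> \<in> canonical_embedding X ` carrier X" if \<Phi>: "\<Phi> \<in> carrier (dual_space ?D)" for \<Phi>
  proof -
    obtain x where x: "x \<in> carrier X" "\<forall>\<phi>\<in>carrier ?D. \<Phi> \<phi> = \<phi> x" using assms[OF \<Phi>] by blast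
    have "\<Phi> = canonical_embedding X x"
      using Dual.dual_extensional[OF \<Phi>] x(2)
      by (intro extensionalityI[of _ "carrier ?D"]) (auto simp: canonical_embedding_def)
    then show ?thesis using x(1) by blast
  qed
  ultimately show ?thesis unfolding reflexive_space_def using normed_space_axioms by blast
qed

end

section \<open>Weak cluster points in reflexive spaces\<close>

text \<open>The limit superior of a bounded real net, as a real number.\<close>
definition upper_limit :: "'j filter \<Rightarrow> ('j \<Rightarrow> real) \<Rightarrow> real"
  where "upper_limit G a = Inf {c. \<forall>\<^sub>F i in G. a i \<le> c}"

context
  fixes G :: "'j filter" and a :: "'j \<Rightarrow> real" and B :: real
  assumes G: "G \<noteq> bot" and bounded: "\<And>i. \<bar>a i\<bar> \<le> B"
begin

lemma eventual_upper_bound_ge: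
  assumes "\<forall>\<^sub>F i in G. d \<le> a i" "\<forall>\<^sub>F i in G. a i \<le> c"
  shows "d \<le> c"
proof -
  have "\<forall>\<^sub>F i in G. d \<le> c" using assms by eventually_elim simp
  then show ?thesis using G by simp
qed

lemma upper_limit_le: "\<forall>\<^sub>F i in G. a i \<le> c \<Longrightarrow> upper_limit G a \<le> c"
  unfolding upper_limit_def
proof (rule cInf_lower)
  have "- B \<le> a i" for i using bounded[of i] by simp
  then show "bdd_below {c. \<forall>\<^sub>F i in G. a i \<le> c}"
    by (intro bdd_belowI[of _ "- B"]) (auto intro: eventual_upper_bound_ge)
qed auto

lemma eventually_le_upper_limit:
  assumes "upper_limit G a < c"
  shows "\<forall>\<^sub>F i in G. a i \<le> c"
proof -
  have "a i \<le> B" for i using bounded[of i] by simp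
  then have "{c. \<forall>\<^sub>F i in G. a i \<le> c} \<noteq> {}" by (auto intro!: exI[of _ B])
  then obtain d where "\<forall>\<^sub>F i in G. a i \<le> d" "d < c"
    using cInf_lessD[of "{c. \<forall>\<^sub>F i in G. a i \<le> c}" c] assms unfolding upper_limit_def by auto
  then show ?thesis by (elim eventually_mono) simp
qed

end

text \<open>The limit superior is itself subadditive and positively homogeneous, which makes it a source of
  sublinear functionals.\<close>
lemma (in real_module) sublinear_upper_limit:
  assumes G: "G \<noteq> bot" and sub: "\<And>i. sublinear X (p i)"
    and bounded: "\<And>i x. x \<in> carrier X \<Longrightarrow> \<bar>p i x\<bar> \<le> b x"
  shows "sublinear X (\<lambda>x. upper_limit G (\<lambda>i. p i x))"
proof (rule sublinearI)
  let ?u = "\<lambda>x. upper_limit G (\<lambda>i. p i x)"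
  have ev: "\<forall>\<^sub>F i in G. p i x \<le> ?u x + e" if "x \<in> carrier X" "0 < e" for x and e :: real
    by (rule eventually_le_upper_limit[OF G bounded[OF that(1)]]) (use that in simp)
  have le: "?u x \<le> c" if "x \<in> carrier X" "\<forall>\<^sub>F i in G. p i x \<le> c" for x c
    by (rule upper_limit_le[OF G bounded[OF that(1)] that(2)])
  show "?u (x \<oplus> y) \<le> ?u x + ?u y" if xy: "x \<in> carrier X" "y \<in> carrier X" for x y
  proof (rule field_le_epsilon)
    fix e :: real assume e: "0 < e"
    have "\<forall>\<^sub>F i in G. p i (x \<oplus> y) \<le> ?u x + ?u y + e"
      using ev[OF xy(1) half_gt_zero[OF e]] ev[OF xy(2) half_gt_zero[OF e]]
    proof eventually_elim
      case (elim i)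
      have "p i (x \<oplus> y) \<le> p i x + p i y" using sub[of i] xy by (simp add: sublinear_def)
      then show ?case using elim by (simp add: field_simps)
    qed
    then show "?u (x \<oplus> y) \<le> ?u x + ?u y + e" using le xy by simp
  qed
  show "?u (a \<odot>\<^bsub>X\<^esub> x) \<le> a * ?u x" if a: "0 < a" and x: "x \<in> carrier X" for a x
  proof (rule field_le_epsilon)
    fix e :: real assume e: "0 < e"
    have "\<forall>\<^sub>F i in G. p i (a \<odot>\<^bsub>X\<^esub> x) \<le> a * ?u x + e"
      using ev[OF x divide_pos_pos[OF e a]]
    proof eventually_elim
      case (elim i)
      then show ?case using sub[of i] a x by (simp add: sublinear_def field_simps)
    qed
    then show "?u (a \<odot>\<^bsub>X\<^esub> x) \<le> a * ?u x + e" using le x by simp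
  qed
qed

text \<open>A substitute for weak compactness of balls.  Evaluations at \<open>x\<^sub>i\<close> are linear on the dual space, so
  their limit superior is sublinear there and dominates a linear functional.  That functional is
  bounded, and by reflexivity it is evaluation at a point \<open>z\<close>.\<close>
lemma (in normed_space) reflexive_cluster_point:
  assumes refl: "reflexive_space X" and G: "G \<noteq> bot"
    and x: "\<And>i. x i \<in> carrier X" and bound: "\<And>i. nrm X (x i) \<le> C"
  obtains z where "z \<in> carrier X"
    "\<And>\<phi>. \<phi> \<in> carrier (dual_space X) \<Longrightarrow> \<phi> z \<le> upper_limit G (\<lambda>i. \<phi> (x i))"
proof -
  let ?D = "dual_space X"
  interpret Dual: normed_space ?D by (rule normed_space_dual)
  have abs_le: "\<bar>\<phi> (x i)\<bar> \<le> C * nrm ?D \<phi>" if "\<phi> \<in> carrier ?D" for \<phi> i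
  proof -
    have "\<bar>\<phi> (x i)\<bar> \<le> nrm ?D \<phi> * nrm X (x i)" using dual_abs_le that x .
    also have "\<dots> \<le> nrm ?D \<phi> * C" using bound dual_nrm_nonneg[OF that] by (intro mult_left_mono)
    finally show ?thesis by (simp add: mult.commute)
  qed
  have "sublinear ?D (\<lambda>\<phi>. \<phi> (x i))" for i
    using x[of i] by (auto simp: sublinear_def dual_space_def)
  then have "sublinear ?D (\<lambda>\<phi>. upper_limit G (\<lambda>i. \<phi> (x i)))"
    by (intro Dual.sublinear_upper_limit[OF G, where b="\<lambda>\<phi>. C * nrm ?D \<phi>"] abs_le)
  then obtain \<Phi> where \<Phi>: "linear_functional ?D \<Phi>"
    "\<And>\<phi>. \<phi> \<in> carrier ?D \<Longrightarrow> \<Phi> \<phi> \<le> upper_limit G (\<lambda>i. \<phi> (x i))"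
    using Dual.dominated_linear_functional by blast
  have "\<Phi> \<phi> \<le> C * nrm ?D \<phi>" if "\<phi> \<in> carrier ?D" for \<phi>
  proof -
    have "upper_limit G (\<lambda>i. \<phi> (x i)) \<le> C * nrm ?D \<phi>"
      using abs_le[OF that] by (intro upper_limit_le[OF G abs_le[OF that]] always_eventually) (auto simp: abs_le_iff)
    then show ?thesis using \<Phi>(2)[OF that] by simp
  qed
  then obtain z where "z \<in> carrier X" "\<And>\<phi>. \<phi> \<in> carrier ?D \<Longrightarrow> \<Phi> \<phi> = \<phi> z"
    using reflexive_bidual[OF refl \<Phi>(1)] by blast
  with \<Phi>(2) show thesis by (intro that) auto
qed

section \<open>Tails in Banach ideal spaces\<close>

text \<open>The zero of the space supplies the entries outside \<open>A\<close>.  Thus one definition serves for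
  sequences of reals and for families of vectors.\<close>
definition truncation :: "'i set \<Rightarrow> ('i \<Rightarrow> 'a) nspace \<Rightarrow> 'i set \<Rightarrow> ('i \<Rightarrow> 'a) \<Rightarrow> 'i \<Rightarrow> 'a"
  where "truncation I Y A f = (\<lambda>\<alpha>\<in>I. if \<alpha> \<in> A then f \<alpha> else \<zero>\<^bsub>Y\<^esub> \<alpha>)"

text \<open>The form in which order continuity is used: truncations to finite sets converge in norm.\<close>
definition vanishing_tails :: "'i set \<Rightarrow> ('i \<Rightarrow> 'a) nspace \<Rightarrow> bool"
  where "vanishing_tails I Y \<longleftrightarrow>
    (\<forall>f\<in>carrier Y. ((\<lambda>A. nrm Y (truncation I Y (- A) f)) \<longlongrightarrow> 0) (finite_subsets_at_top I))"

context banach_ideal_space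
begin

lemma ideal_mem: "x \<in> extensional I \<Longrightarrow> y \<in> carrier E \<Longrightarrow> (\<And>\<alpha>. \<alpha> \<in> I \<Longrightarrow> \<bar>x \<alpha>\<bar> \<le> \<bar>y \<alpha>\<bar>) \<Longrightarrow>
    x \<in> carrier E"
  using ideal by blast

lemma ideal_nrm_le: "x \<in> extensional I \<Longrightarrow> y \<in> carrier E \<Longrightarrow> (\<And>\<alpha>. \<alpha> \<in> I \<Longrightarrow> \<bar>x \<alpha>\<bar> \<le> \<bar>y \<alpha>\<bar>) \<Longrightarrow>
    nrm E x \<le> nrm E y"
  using ideal by blast

lemma carrier_eqI:
  "x \<in> carrier E \<Longrightarrow> y \<in> carrier E \<Longrightarrow> (\<And>\<alpha>. \<alpha> \<in> I \<Longrightarrow> x \<alpha> = y \<alpha>) \<Longrightarrow> x = y"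
  using extensional_carrier by (metis extensionalityI subsetD)

lemma add_apply: "x \<in> carrier E \<Longrightarrow> y \<in> carrier E \<Longrightarrow> \<alpha> \<in> I \<Longrightarrow> (x \<oplus> y) \<alpha> = x \<alpha> + y \<alpha>"
  by (simp add: add_pointwise)

lemma smult_apply: "x \<in> carrier E \<Longrightarrow> \<alpha> \<in> I \<Longrightarrow> (a \<odot>\<^bsub>E\<^esub> x) \<alpha> = a * x \<alpha>"
  by (simp add: smult_pointwise)

lemma zero_apply: "\<alpha> \<in> I \<Longrightarrow> \<zero> \<alpha> = 0"
  by (simp add: zero_pointwise)

lemma truncation_apply: "\<alpha> \<in> I \<Longrightarrow> truncation I E A x \<alpha> = (if \<alpha> \<in> A then x \<alpha> else 0)"
  by (simp add: truncation_def zero_pointwise)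

lemma truncation_extensional: "truncation I E A x \<in> extensional I"
  by (simp add: truncation_def)

lemma truncation_mem: "x \<in> carrier E \<Longrightarrow> truncation I E A x \<in> carrier E"
  by (rule ideal_mem[OF truncation_extensional]) (auto simp: truncation_apply)

lemma truncation_nrm_mono: "x \<in> carrier E \<Longrightarrow> A \<inter> I \<subseteq> B \<Longrightarrow> nrm E (truncation I E A x) \<le> nrm E (truncation I E B x)"
  by (rule ideal_nrm_le[OF truncation_extensional truncation_mem]) (auto simp: truncation_apply)

lemma truncation_nrm_le: "x \<in> carrier E \<Longrightarrow> nrm E (truncation I E A x) \<le> nrm E x"
  by (rule ideal_nrm_le[OF truncation_extensional]) (auto simp: truncation_apply)

lemma truncation_add: "x \<in> carrier E \<Longrightarrow> y \<in> carrier E \<Longrightarrow> truncation I E A (x \<oplus> y) = truncation I E A x \<oplus> truncation I E A y"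
  by (rule carrier_eqI) (auto simp: truncation_mem truncation_apply add_apply)

lemma truncation_smult: "x \<in> carrier E \<Longrightarrow> truncation I E A (a \<odot>\<^bsub>E\<^esub> x) = a \<odot>\<^bsub>E\<^esub> truncation I E A x"
  by (rule carrier_eqI) (auto simp: truncation_mem truncation_apply smult_apply)

lemma truncation_split: "x \<in> carrier E \<Longrightarrow> x = truncation I E A x \<oplus> truncation I E (- A) x"
  by (rule carrier_eqI) (auto simp: truncation_mem truncation_apply add_apply)

text \<open>The norm of a tail decreases as the finite set grows, so one small tail for each bound is enough.\<close>
lemma vanishing_tailsI:
  assumes "\<And>x e. x \<in> carrier E \<Longrightarrow> 0 < e \<Longrightarrow>
    \<exists>A. finite A \<and> A \<subseteq> I \<and> nrm E (truncation I E (- A) x) \<le> e"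
  shows "vanishing_tails I E"
  unfolding vanishing_tails_def
proof (intro ballI tendstoI)
  fix x and e :: real assume x: "x \<in> carrier E" and e: "0 < e"
  obtain A where A: "finite A" "A \<subseteq> I" "nrm E (truncation I E (- A) x) \<le> e / 2"
    using assms[OF x half_gt_zero[OF e]] by blast
  have "dist (nrm E (truncation I E (- B) x)) 0 < e" if "A \<subseteq> B" for B
  proof -
    have "nrm E (truncation I E (- B) x) \<le> nrm E (truncation I E (- A) x)"
      using that by (intro truncation_nrm_mono[OF x]) auto
    then show ?thesis using A(3) e nrm_nonneg[OF truncation_mem[OF x], of "- B"] by simp
  qed
  then show "\<forall>\<^sub>F B in finite_subsets_at_top I. dist (nrm E (truncation I E (- B) x)) 0 < e"
    using A unfolding eventually_finite_subsets_at_top by blast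
qed

lemma unit_vector_mem:
  assumes "\<alpha> \<in> I"
  shows "(\<lambda>\<beta>\<in>I. if \<beta> = \<alpha> then 1 else 0) \<in> carrier E"
proof -
  obtain w where w: "w \<in> carrier E" "\<forall>\<beta>\<in>I. 0 < w \<beta>" using strictly_positive by blast
  show ?thesis
    by (rule ideal_mem[of _ "inverse (w \<alpha>) \<odot>\<^bsub>E\<^esub> w"]) (use assms w in \<open>auto simp: smult_apply\<close>)
qed

text \<open>Membership and value are proved together because the induction step needs both.\<close>
lemma linear_finitely_supported:
  assumes \<phi>: "linear_functional E \<phi>" and A: "finite A" "A \<subseteq> I"
  shows "(\<lambda>\<alpha>\<in>I. if \<alpha> \<in> A then v \<alpha> else 0) \<in> carrier E \<and>
    \<phi> (\<lambda>\<alpha>\<in>I. if \<alpha> \<in> A then v \<alpha> else 0) = (\<Sum>\<alpha>\<in>A. v \<alpha> * \<phi> (\<lambda>\<beta>\<in>I. if \<beta> = \<alpha> then 1 else 0))"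
  using A
proof (induction A)
  case empty
  have "(\<lambda>\<alpha>\<in>I. if \<alpha> \<in> {} then v \<alpha> else 0) = \<zero>" by (simp add: zero_pointwise)
  then show ?case using linear_zero[OF \<phi>] M.zero_closed by simp
next
  case (insert \<alpha> A)
  let ?x = "\<lambda>\<beta>\<in>I. if \<beta> \<in> A then v \<beta> else 0" and ?e = "\<lambda>\<beta>\<in>I. if \<beta> = \<alpha> then 1 else 0 :: real"
  have x: "?x \<in> carrier E" and \<phi>x: "\<phi> ?x = (\<Sum>\<beta>\<in>A. v \<beta> * \<phi> (\<lambda>\<gamma>\<in>I. if \<gamma> = \<beta> then 1 else 0))"
    using insert.IH insert.prems by blast+
  have e: "?e \<in> carrier E" using unit_vector_mem insert.prems by blast
  have "(\<lambda>\<beta>\<in>I. if \<beta> \<in> insert \<alpha> A then v \<beta> else 0) = v \<alpha> \<odot>\<^bsub>E\<^esub> ?e \<oplus> ?x"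
    using x e insert.hyps
    by (intro extensionalityI[of _ I]) (auto simp: add_apply smult_apply add_pointwise)
  moreover have ve: "v \<alpha> \<odot>\<^bsub>E\<^esub> ?e \<in> carrier E" using e by (rule real_module_rules(3))
  moreover have "\<phi> (v \<alpha> \<odot>\<^bsub>E\<^esub> ?e) = v \<alpha> * \<phi> ?e"
    using \<phi> e unfolding linear_functional_def by blast
  moreover have "\<phi> (v \<alpha> \<odot>\<^bsub>E\<^esub> ?e \<oplus> ?x) = \<phi> (v \<alpha> \<odot>\<^bsub>E\<^esub> ?e) + \<phi> ?x"
    using \<phi> ve x unfolding linear_functional_def by blast
  moreover have "v \<alpha> \<odot>\<^bsub>E\<^esub> ?e \<oplus> ?x \<in> carrier E" using ve x by (rule M.a_closed)
  ultimately show ?case using \<phi>x by (simp only: sum.insert[OF insert.hyps] simp_thms)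
qed

text \<open>By the ideal property, the multiple \<open>x\<^sub>\<alpha>\<close> of the unit vector at \<open>\<alpha>\<close> has norm at most that of \<open>x\<close>.\<close>
lemma coordinate_bound:
  assumes \<alpha>: "\<alpha> \<in> I"
  obtains C where "\<And>x. x \<in> carrier E \<Longrightarrow> \<bar>x \<alpha>\<bar> \<le> C * nrm E x"
proof -
  let ?e = "\<lambda>\<beta>\<in>I. if \<beta> = \<alpha> then 1 else 0 :: real"
  have e: "?e \<in> carrier E" using unit_vector_mem[OF \<alpha>] .
  have "?e \<noteq> \<zero>" using \<alpha> by (auto simp: zero_pointwise fun_eq_iff)
  then have pos: "0 < nrm E ?e" using nrm_nonneg[OF e] nrm_eq_0[OF e] by simp
  have "\<bar>x \<alpha>\<bar> \<le> inverse (nrm E ?e) * nrm E x" if x: "x \<in> carrier E" for x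
  proof -
    have "nrm E (x \<alpha> \<odot>\<^bsub>E\<^esub> ?e) \<le> nrm E x"
      by (rule ideal_nrm_le) (use e x extensional_carrier in \<open>auto simp: smult_apply\<close>)
    then show ?thesis using pos e by (simp add: nrm_smult field_simps)
  qed
  then show thesis by (rule that)
qed

lemma coordinate_functional:
  assumes "\<alpha> \<in> I"
  shows "(\<lambda>x\<in>carrier E. x \<alpha>) \<in> carrier (dual_space E)"
proof -
  obtain C where "\<And>x. x \<in> carrier E \<Longrightarrow> \<bar>x \<alpha>\<bar> \<le> C * nrm E x"
    using coordinate_bound[OF assms] by blast
  then have "x \<alpha> \<le> C * nrm E x" if "x \<in> carrier E" for x using that abs_le_D1 by blast
  then show ?thesis
    using assms by (intro dual_memI) (auto simp: linear_functional_def add_apply smult_apply)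
qed

text \<open>Enumerating the countable set \<open>I\<close> exhausts it by finite sets.  The tails of \<open>\<bar>x\<bar>\<close> along this
  exhaustion decrease, and since each index eventually leaves the tail, their infimum is zero.\<close>
lemma order_continuous_vanishing_tails:
  assumes "countable I" and oc: "order_continuous E (pointwise_le I)"
  shows "vanishing_tails I E"
proof (rule vanishing_tailsI)
  fix x and e :: real assume x: "x \<in> carrier E" and e: "0 < e"
  define A where "A n = {\<alpha> \<in> I. to_nat_on I \<alpha> < n}" for n
  have fin: "finite (A n)" "A n \<subseteq> I" for n
  proof -
    have "inj_on (to_nat_on I) (A n)"
      using inj_on_to_nat_on[OF assms(1)] by (rule inj_on_subset) (auto simp: A_def)
    moreover have "finite (to_nat_on I ` A n)"
      by (rule finite_subset[of _ "{..<n}"]) (auto simp: A_def)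
    ultimately show "finite (A n)" by (rule finite_imageD[rotated])
  qed (auto simp: A_def)
  define y where "y = (\<lambda>\<alpha>\<in>I. \<bar>x \<alpha>\<bar>)"
  have y: "y \<in> carrier E" by (rule ideal_mem[OF _ x]) (auto simp: y_def)
  define f where "f n = truncation I E (- A n) y" for n
  have f_mem: "f n \<in> carrier E" for n using truncation_mem[OF y] by (simp add: f_def)
  have "pointwise_le I (f (Suc n)) (f n)" for n
    by (auto simp: pointwise_le_def f_def truncation_apply y_def A_def)
  moreover have "is_glb \<lparr>carrier = carrier E, eq = (=), le = pointwise_le I\<rparr> \<zero> (range f)"
  proof -
    have "z \<alpha> \<le> 0" if z: "\<And>n. pointwise_le I z (f n)" and \<alpha>: "\<alpha> \<in> I" for z \<alpha>
    proof -
      have "\<alpha> \<in> A (Suc (to_nat_on I \<alpha>))" using \<alpha> by (simp add: A_def)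
      then have "f (Suc (to_nat_on I \<alpha>)) \<alpha> = 0" using \<alpha> by (simp add: f_def truncation_apply)
      then show ?thesis using z[of "Suc (to_nat_on I \<alpha>)"] \<alpha> by (auto simp: pointwise_le_def)
    qed
    moreover have "pointwise_le I \<zero> (f n)" for n
      by (auto simp: pointwise_le_def f_def truncation_apply y_def zero_apply)
    ultimately show ?thesis
      using f_mem by (auto simp: greatest_def Lower_def pointwise_le_def zero_apply)
  qed
  ultimately have "(\<lambda>n. nrm E (f n)) \<longlonglongrightarrow> 0"
    using oc f_mem unfolding order_continuous_def by blast
  then have "\<forall>\<^sub>F n in sequentially. nrm E (f n) < e" using e by (rule order_tendstoD)
  then obtain n where n: "nrm E (f n) < e" using eventually_happens'[OF sequentially_bot] by blast
  have "nrm E (truncation I E (- A n) x) \<le> nrm E (f n)"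
    using f_mem by (intro ideal_nrm_le truncation_extensional) (auto simp: f_def truncation_apply y_def)
  then show "\<exists>A. finite A \<and> A \<subseteq> I \<and> nrm E (truncation I E (- A) x) \<le> e"
    using fin n by (intro exI[of _ "A n"]) auto
qed

text \<open>Coordinates are bounded functionals, so the cluster point has the expected coordinates.  The bound
  from below in the last conclusion is the bound from above for \<open>- \<phi>\<close>.\<close>
lemma reflexive_coordinatewise_limit:
  assumes refl: "reflexive_space E" and G: "G \<noteq> bot"
    and x: "\<And>i. x i \<in> carrier E" and bound: "\<And>i. nrm E (x i) \<le> C"
    and const: "\<And>\<alpha>. \<alpha> \<in> I \<Longrightarrow> \<forall>\<^sub>F i in G. x i \<alpha> = a \<alpha>"
  obtains z where "z \<in> carrier E" "\<And>\<alpha>. \<alpha> \<in> I \<Longrightarrow> z \<alpha> = a \<alpha>"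
    "\<And>\<phi> c. \<phi> \<in> carrier (dual_space E) \<Longrightarrow> \<forall>\<^sub>F i in G. c \<le> \<phi> (x i) \<Longrightarrow> c \<le> \<phi> z"
proof -
  interpret Dual: normed_space "dual_space E" by (rule normed_space_dual)
  obtain z where z: "z \<in> carrier E"
    and cluster: "\<And>\<phi>. \<phi> \<in> carrier (dual_space E) \<Longrightarrow> \<phi> z \<le> upper_limit G (\<lambda>i. \<phi> (x i))"
  proof (rule reflexive_cluster_point[of G x C, OF refl G x bound])
    fix z
    assume "z \<in> carrier E"
      "\<And>\<phi>. \<phi> \<in> carrier (dual_space E) \<Longrightarrow> \<phi> z \<le> upper_limit G (\<lambda>i. \<phi> (x i))"
    then show thesis by (rule that)
  qed
  have le: "\<psi> z \<le> c" if \<psi>: "\<psi> \<in> carrier (dual_space E)" and ev: "\<forall>\<^sub>F i in G. \<psi> (x i) \<le> c" for \<psi> c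
  proof -
    have "\<bar>\<psi> (x i)\<bar> \<le> nrm (dual_space E) \<psi> * C" for i
    proof -
      have "\<bar>\<psi> (x i)\<bar> \<le> nrm (dual_space E) \<psi> * nrm E (x i)" using dual_abs_le[OF \<psi> x] .
      also have "\<dots> \<le> nrm (dual_space E) \<psi> * C"
        using bound dual_nrm_nonneg[OF \<psi>] by (intro mult_left_mono)
      finally show ?thesis .
    qed
    then have "upper_limit G (\<lambda>i. \<psi> (x i)) \<le> c" using ev by (rule upper_limit_le[OF G])
    then show ?thesis using cluster[OF \<psi>] by simp
  qed
  have ge: "c \<le> \<psi> z" if \<psi>: "\<psi> \<in> carrier (dual_space E)" and ev: "\<forall>\<^sub>F i in G. c \<le> \<psi> (x i)" for \<psi> c
  proof -
    have neg: "((- 1) \<odot>\<^bsub>dual_space E\<^esub> \<psi>) y = - \<psi> y" if "y \<in> carrier E" for y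
      using that by (simp add: dual_space_def)
    have "((- 1) \<odot>\<^bsub>dual_space E\<^esub> \<psi>) z \<le> - c"
      by (rule le[OF Dual.smult_closed[OF _ \<psi>]]) (use ev x in \<open>simp_all add: neg\<close>)
    then show ?thesis using z by (simp add: neg)
  qed
  have "z \<alpha> = a \<alpha>" if \<alpha>: "\<alpha> \<in> I" for \<alpha>
  proof -
    let ?c = "\<lambda>x\<in>carrier E. x \<alpha>"
    have c: "?c \<in> carrier (dual_space E)" using coordinate_functional[OF \<alpha>] .
    have "\<forall>\<^sub>F i in G. ?c (x i) \<le> a \<alpha>" "\<forall>\<^sub>F i in G. a \<alpha> \<le> ?c (x i)"
      using const[OF \<alpha>] x by (auto elim: eventually_mono)
    then have "?c z \<le> a \<alpha> \<and> a \<alpha> \<le> ?c z" using le[OF c] ge[OF c] by blast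
    then show ?thesis using z by simp
  qed
  then show thesis using z ge by (intro that)
qed

text \<open>All coordinates of the cluster point vanish, hence so does the point, while a functional that
  stays above \<open>e\<close> on the net would have to be at least \<open>e\<close> there.\<close>
lemma reflexive_coordinatewise_null:
  assumes refl: "reflexive_space E" and G: "G \<noteq> bot"
    and x: "\<And>i. x i \<in> carrier E" and bound: "\<And>i. nrm E (x i) \<le> C"
    and null: "\<And>\<alpha>. \<alpha> \<in> I \<Longrightarrow> \<forall>\<^sub>F i in G. x i \<alpha> = 0"
    and \<phi>: "\<phi> \<in> carrier (dual_space E)" and e: "0 < e"
  shows "\<not> (\<forall>\<^sub>F i in G. e \<le> \<phi> (x i))"
proof
  assume large: "\<forall>\<^sub>F i in G. e \<le> \<phi> (x i)"
  show False
  proof (rule reflexive_coordinatewise_limit[OF refl G x bound null])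
    fix z assume z: "z \<in> carrier E" "\<And>\<alpha>. \<alpha> \<in> I \<Longrightarrow> z \<alpha> = 0"
      and ge: "\<And>\<phi> c. \<phi> \<in> carrier (dual_space E) \<Longrightarrow> \<forall>\<^sub>F i in G. c \<le> \<phi> (x i) \<Longrightarrow> c \<le> \<phi> z"
    have "z = \<zero>" using z by (intro carrier_eqI) (auto simp: zero_apply)
    moreover have "e \<le> \<phi> z" using ge[OF \<phi> large] .
    ultimately show False using linear_zero[OF dual_linear[OF \<phi>]] e by simp
  qed
qed

text \<open>The limit \<open>p\<close> of the norms of the tails is a seminorm, and it vanishes on finitely supported
  sequences.  A functional \<open>\<phi> \<le> p\<close> with \<open>\<phi> x = p x\<close> therefore takes on every tail of \<open>x\<close> at least the
  value \<open>p x\<close>.  But tails are coordinatewise null, so \<open>p x\<close> cannot be positive.\<close>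
lemma reflexive_vanishing_tails:
  assumes refl: "reflexive_space E"
  shows "vanishing_tails I E"
proof (rule vanishing_tailsI)
  fix x and e :: real assume x: "x \<in> carrier E" and e: "0 < e"
  let ?G = "finite_subsets_at_top I"
  define p where "p y = upper_limit ?G (\<lambda>A. nrm E (truncation I E (- A) y))" for y
  have abs_le: "\<bar>nrm E (truncation I E A y)\<bar> \<le> nrm E y" if "y \<in> carrier E" for A y
    using truncation_nrm_le[OF that] nrm_nonneg[OF truncation_mem[OF that]] by simp
  have "sublinear E (\<lambda>y. nrm E (truncation I E A y))" for A
    by (simp add: sublinear_def truncation_add truncation_smult truncation_mem nrm_triangle nrm_smult)
  then have "sublinear E p"
    unfolding p_def by (intro sublinear_upper_limit[where b="nrm E"] abs_le) auto
  then obtain \<phi> where \<phi>: "linear_functional E \<phi>" "\<And>y. y \<in> carrier E \<Longrightarrow> \<phi> y \<le> p y" "\<phi> x = p x"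
    using hahn_banach x by blast
  have "p x < e"
  proof (rule ccontr)
    assume "\<not> p x < e"
    have p_le: "p y \<le> nrm E y" if "y \<in> carrier E" for y
      unfolding p_def using truncation_nrm_le[OF that]
      by (intro upper_limit_le[OF finite_subsets_at_top_neq_bot abs_le[OF that]]) simp
    let ?\<phi> = "restrict \<phi> (carrier E)"
    have "?\<phi> \<in> carrier (dual_space E)"
      using \<phi>(1,2) p_le by (intro dual_memI[where C=1]) (auto intro: order_trans)
    moreover have "e \<le> ?\<phi> (truncation I E (- A) x)" if A: "finite A" "A \<subseteq> I" for A
    proof -
      have "p (truncation I E A x) \<le> 0"
        unfolding p_def
      proof (rule upper_limit_le[OF finite_subsets_at_top_neq_bot abs_le[OF truncation_mem[OF x]]])
        have "truncation I E (- B) (truncation I E A x) = \<zero>" if "A \<subseteq> B" for B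
          using that x by (intro carrier_eqI) (auto simp: truncation_mem truncation_apply zero_apply)
        then show "\<forall>\<^sub>F B in ?G. nrm E (truncation I E (- B) (truncation I E A x)) \<le> 0"
          using A unfolding eventually_finite_subsets_at_top by (intro exI[of _ A]) auto
      qed
      then have "\<phi> (truncation I E A x) \<le> 0" using \<phi>(2)[OF truncation_mem[OF x]] by (rule order_trans[rotated])
      moreover have "\<phi> x = \<phi> (truncation I E A x) + \<phi> (truncation I E (- A) x)"
        using \<phi>(1) truncation_split[OF x, of A] truncation_mem[OF x] unfolding linear_functional_def by metis
      ultimately show ?thesis using \<phi>(3) \<open>\<not> p x < e\<close> truncation_mem[OF x] by simp
    qed
    then have "\<forall>\<^sub>F A in ?G. e \<le> ?\<phi> (truncation I E (- A) x)"
      unfolding eventually_finite_subsets_at_top by (intro exI[of _ "{}"]) auto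
    moreover have "\<forall>\<^sub>F A in ?G. truncation I E (- A) x \<alpha> = 0" if "\<alpha> \<in> I" for \<alpha>
      using that unfolding eventually_finite_subsets_at_top by (intro exI[of _ "{\<alpha>}"]) (auto simp: truncation_apply)
    ultimately show False
      using reflexive_coordinatewise_null[OF refl finite_subsets_at_top_neq_bot truncation_mem[OF x] truncation_nrm_le[OF x] _ _ e]
      by blast
  qed
  then have "\<forall>\<^sub>F A in ?G. nrm E (truncation I E (- A) x) \<le> e"
    unfolding p_def by (intro eventually_le_upper_limit[OF finite_subsets_at_top_neq_bot abs_le[OF x]])
  then show "\<exists>A. finite A \<and> A \<subseteq> I \<and> nrm E (truncation I E (- A) x) \<le> e"
    unfolding eventually_finite_subsets_at_top by blast
qed

end

section \<open>Membership in the Koethe dual\<close>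

context banach_ideal_space
begin

text \<open>Bounds on finite partial sums of \<open>\<bar>x\<^sub>\<alpha>\<bar> \<bar>y\<^sub>\<alpha>\<bar>\<close> give absolute convergence and the norm estimate at
  once.\<close>
lemma kothe_memI:
  assumes y: "y \<in> extensional I" and C: "0 \<le> C"
    and bound: "\<And>x A. x \<in> carrier E \<Longrightarrow> finite A \<Longrightarrow> A \<subseteq> I \<Longrightarrow> (\<Sum>\<alpha>\<in>A. \<bar>x \<alpha>\<bar> * \<bar>y \<alpha>\<bar>) \<le> C * nrm E x"
  shows "y \<in> carrier (kothe_dual I E)" and "nrm (kothe_dual I E) y \<le> C"
proof -
  have abs_summable: "(\<lambda>\<alpha>. \<bar>x \<alpha>\<bar> * \<bar>y \<alpha>\<bar>) summable_on I" if "x \<in> carrier E" for x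
    by (rule nonneg_bdd_above_summable_on)
      (use bound[OF that] in \<open>auto intro!: bdd_aboveI2[where M="C * nrm E x"]\<close>)
  then have summable: "(\<lambda>\<alpha>. x \<alpha> * y \<alpha>) summable_on I" if "x \<in> carrier E" for x
    using that by (subst summable_on_iff_abs_summable_on_real) (simp add: abs_mult)
  have le: "(\<Sum>\<^sub>\<infinity>\<alpha>\<in>I. x \<alpha> * y \<alpha>) \<le> C * nrm E x" if x: "x \<in> carrier E" for x
  proof -
    have "x \<alpha> * y \<alpha> \<le> \<bar>x \<alpha>\<bar> * \<bar>y \<alpha>\<bar>" for \<alpha> by (simp flip: abs_mult)
    then have "(\<Sum>\<^sub>\<infinity>\<alpha>\<in>I. x \<alpha> * y \<alpha>) \<le> (\<Sum>\<^sub>\<infinity>\<alpha>\<in>I. \<bar>x \<alpha>\<bar> * \<bar>y \<alpha>\<bar>)"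
      by (rule infsum_mono[OF summable[OF x] abs_summable[OF x]])
    also have "\<dots> \<le> C * nrm E x"
      by (rule infsum_le_finite_sums[OF abs_summable[OF x]]) (use bound[OF x] in auto)
    finally show ?thesis .
  qed
  have "(\<Sum>\<^sub>\<infinity>\<alpha>\<in>I. (x1 \<oplus>\<^bsub>E\<^esub> x2) \<alpha> * y \<alpha>) = (\<Sum>\<^sub>\<infinity>\<alpha>\<in>I. x1 \<alpha> * y \<alpha>) + (\<Sum>\<^sub>\<infinity>\<alpha>\<in>I. x2 \<alpha> * y \<alpha>)"
    if "x1 \<in> carrier E" "x2 \<in> carrier E" for x1 x2
    using infsum_add[OF summable[OF that(1)] summable[OF that(2)]] that
    by (simp add: add_apply distrib_right cong: infsum_cong)
  moreover have "(\<Sum>\<^sub>\<infinity>\<alpha>\<in>I. (a \<odot>\<^bsub>E\<^esub> x) \<alpha> * y \<alpha>) = a * (\<Sum>\<^sub>\<infinity>\<alpha>\<in>I. x \<alpha> * y \<alpha>)" if "x \<in> carrier E" for a x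
    using that by (simp add: smult_apply mult.assoc infsum_cmult_right' cong: infsum_cong)
  ultimately have lin: "linear_functional E (\<lambda>x. \<Sum>\<^sub>\<infinity>\<alpha>\<in>I. x \<alpha> * y \<alpha>)"
    by (simp add: linear_functional_def)
  then have mem: "sequence_functional I E y \<in> carrier (dual_space E)"
    unfolding sequence_functional_def using le by (rule dual_memI)
  then show "y \<in> carrier (kothe_dual I E)"
    using y summable by (simp add: kothe_dual_def)
  have "nrm (dual_space E) (sequence_functional I E y) \<le> C"
    using le C dual_linear[OF mem] by (intro dual_norm_le) (auto simp: sequence_functional_def)
  then show "nrm (kothe_dual I E) y \<le> C" by (simp add: kothe_dual_def)
qed

lemma kothe_summable:
  "y \<in> carrier (kothe_dual I E) \<Longrightarrow> x \<in> carrier E \<Longrightarrow> (\<lambda>\<alpha>. x \<alpha> * y \<alpha>) summable_on I"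
  by (simp add: kothe_dual_def)

lemma kothe_functional: "y \<in> carrier (kothe_dual I E) \<Longrightarrow> sequence_functional I E y \<in> carrier (dual_space E)"
  by (simp add: kothe_dual_def)

lemma kothe_infsum_le:
  assumes "y \<in> carrier (kothe_dual I E)" "x \<in> carrier E"
  shows "(\<Sum>\<^sub>\<infinity>\<alpha>\<in>I. x \<alpha> * y \<alpha>) \<le> nrm (kothe_dual I E) y * nrm E x"
  using dual_le[OF kothe_functional[OF assms(1)] assms(2)] assms(2)
  by (simp add: sequence_functional_def kothe_dual_def)

lemma kothe_nrm_nonneg: "y \<in> carrier (kothe_dual I E) \<Longrightarrow> 0 \<le> nrm (kothe_dual I E) y"
  using dual_nrm_nonneg[OF kothe_functional] by (simp add: kothe_dual_def)

end

section \<open>Direct sums and the components of a functional\<close>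

locale ideal_direct_sum = banach_ideal_space I E
  for I :: "'i set" and E :: "('i \<Rightarrow> real) nspace" +
  fixes X :: "'i \<Rightarrow> 'a nspace"
  assumes normed_component: "\<alpha> \<in> I \<Longrightarrow> normed_space (X \<alpha>)"
begin

abbreviation "D \<equiv> direct_sum I E X"

abbreviation "norm_seq f \<equiv> (\<lambda>\<alpha>\<in>I. nrm (X \<alpha>) (f \<alpha>))"

lemma real_module_component: "\<alpha> \<in> I \<Longrightarrow> real_module (X \<alpha>)"
  using normed_component by (simp add: normed_space.axioms(1) real_module_def)

lemmas component_rules = real_module.real_module_rules[OF real_module_component]

lemmas component_nrm_nonneg = normed_space.nrm_nonneg[OF normed_component]

lemma carrier_D: "f \<in> carrier D \<longleftrightarrow>
    f \<in> extensional I \<and> (\<forall>\<alpha>\<in>I. f \<alpha> \<in> carrier (X \<alpha>)) \<and> norm_seq f \<in> carrier E"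
  by (auto simp: direct_sum_def PiE_iff)

lemma D_apply:
  "\<alpha> \<in> I \<Longrightarrow> (f \<oplus>\<^bsub>D\<^esub> g) \<alpha> = f \<alpha> \<oplus>\<^bsub>X \<alpha>\<^esub> g \<alpha>"
  "\<alpha> \<in> I \<Longrightarrow> (a \<odot>\<^bsub>D\<^esub> f) \<alpha> = a \<odot>\<^bsub>X \<alpha>\<^esub> f \<alpha>"
  "\<alpha> \<in> I \<Longrightarrow> \<zero>\<^bsub>D\<^esub> \<alpha> = \<zero>\<^bsub>X \<alpha>\<^esub>"
  by (simp_all add: direct_sum_def)

lemma D_extensional:
  "f \<oplus>\<^bsub>D\<^esub> g \<in> extensional I" "a \<odot>\<^bsub>D\<^esub> f \<in> extensional I" "\<zero>\<^bsub>D\<^esub> \<in> extensional I"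
  by (simp_all add: direct_sum_def)

lemma nrm_D: "nrm D f = nrm E (norm_seq f)"
  by (simp add: direct_sum_def)

text \<open>The ideal property for families: it reduces membership in the direct sum, and norm bounds, to
  sequences in \<open>E\<close>.\<close>
lemma dominated:
  assumes f: "f \<in> extensional I" "\<And>\<alpha>. \<alpha> \<in> I \<Longrightarrow> f \<alpha> \<in> carrier (X \<alpha>)"
    and x: "x \<in> carrier E" and le: "\<And>\<alpha>. \<alpha> \<in> I \<Longrightarrow> nrm (X \<alpha>) (f \<alpha>) \<le> \<bar>x \<alpha>\<bar>"
  shows "f \<in> carrier D" and "nrm D f \<le> nrm E x"
proof -
  have "norm_seq f \<in> extensional I" "\<And>\<alpha>. \<alpha> \<in> I \<Longrightarrow> \<bar>norm_seq f \<alpha>\<bar> \<le> \<bar>x \<alpha>\<bar>"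
    using le component_nrm_nonneg f by auto
  then have "norm_seq f \<in> carrier E \<and> nrm E (norm_seq f) \<le> nrm E x"
    by (rule ideal[OF _ x])
  then show "f \<in> carrier D" "nrm D f \<le> nrm E x" using f by (auto simp: carrier_D nrm_D)
qed

lemma D_mem:
  assumes "f \<in> carrier D"
  shows "norm_seq f \<in> carrier E" "\<And>\<alpha>. \<alpha> \<in> I \<Longrightarrow> f \<alpha> \<in> carrier (X \<alpha>)" "f \<in> extensional I"
  using assms by (auto simp: carrier_D)

lemmas D_eqI = extensionalityI[of _ I]

text \<open>The algebraic laws hold coordinatewise.  The norm inequalities come from those of the
  \<open>X\<^sub>\<alpha>\<close> by monotonicity of the norm of \<open>E\<close>.\<close>
lemma normed_space_D: "normed_space D"
proof (rule normed_spaceI)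
  note component_nrm = normed_space.nrm_triangle[OF normed_component]
    normed_space.nrm_smult[OF normed_component]
  have sum: "f \<oplus>\<^bsub>D\<^esub> g \<in> carrier D \<and> nrm D (f \<oplus>\<^bsub>D\<^esub> g) \<le> nrm E (norm_seq f \<oplus>\<^bsub>E\<^esub> norm_seq g)"
    if "f \<in> carrier D" "g \<in> carrier D" for f g
    using that D_mem[OF that(1)] D_mem[OF that(2)] component_nrm_nonneg
    by (intro conjI dominated[where x="norm_seq f \<oplus>\<^bsub>E\<^esub> norm_seq g"])
      (auto simp: D_apply D_extensional add_apply component_rules abs_of_nonneg intro: component_nrm)
  then show "f \<oplus>\<^bsub>D\<^esub> g \<in> carrier D" if "f \<in> carrier D" "g \<in> carrier D" for f g
    using that by blast
  show "nrm D (f \<oplus>\<^bsub>D\<^esub> g) \<le> nrm D f + nrm D g" if "f \<in> carrier D" "g \<in> carrier D" for f g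
    using order_trans[OF conjunct2[OF sum[OF that]] nrm_triangle[OF D_mem(1)[OF that(1)] D_mem(1)[OF that(2)]]]
    unfolding nrm_D .
  have seq_smult: "norm_seq (a \<odot>\<^bsub>D\<^esub> f) = \<bar>a\<bar> \<odot>\<^bsub>E\<^esub> norm_seq f" if "f \<in> carrier D" for a f
    using D_mem[OF that] smult_pointwise[of "norm_seq f"]
    by (auto simp: D_apply component_nrm fun_eq_iff)
  show "a \<odot>\<^bsub>D\<^esub> f \<in> carrier D" if "f \<in> carrier D" for a f
    using D_mem[OF that] seq_smult[OF that] 
    by (auto simp: carrier_D D_apply D_extensional component_rules simp del: smult_pointwise)
  show "nrm D (a \<odot>\<^bsub>D\<^esub> f) = \<bar>a\<bar> * nrm D f" if "f \<in> carrier D" for a f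
    using seq_smult[OF that] D_mem[OF that] by (simp add: nrm_D nrm_smult)
  have seq_zero: "norm_seq \<zero>\<^bsub>D\<^esub> = \<zero>\<^bsub>E\<^esub>"
    by (auto simp: D_apply zero_pointwise normed_space.nrm_zero[OF normed_component] fun_eq_iff)
  then show "\<zero>\<^bsub>D\<^esub> \<in> carrier D"
    by (auto simp: carrier_D D_apply D_extensional component_rules)
  show "nrm D \<zero>\<^bsub>D\<^esub> = 0" by (simp add: nrm_D seq_zero)
  show "f = \<zero>\<^bsub>D\<^esub>" if f: "f \<in> carrier D" "nrm D f = 0" for f
  proof (rule D_eqI)
    have "norm_seq f = \<zero>\<^bsub>E\<^esub>" using f D_mem nrm_eq_0 by (simp add: nrm_D)
    then have "nrm (X \<alpha>) (f \<alpha>) = 0" if "\<alpha> \<in> I" for \<alpha>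
      using that zero_apply by (metis restrict_apply')
    then show "f \<alpha> = \<zero>\<^bsub>D\<^esub> \<alpha>" if "\<alpha> \<in> I" for \<alpha>
      using that D_mem[OF f(1)] normed_space.nrm_eq_0[OF normed_component] by (simp add: D_apply)
  qed (use D_mem[OF f(1)] D_extensional in auto)
qed (rule D_eqI; simp add: D_extensional D_mem D_apply; rule component_rules; simp add: D_mem)+


lemma truncation_D_apply: "\<alpha> \<in> I \<Longrightarrow> truncation I D A f \<alpha> = (if \<alpha> \<in> A then f \<alpha> else \<zero>\<^bsub>X \<alpha>\<^esub>)"
  by (simp add: truncation_def D_apply)

lemma truncation_D_extensional: "truncation I D A f \<in> extensional I"
  by (simp add: truncation_def)

lemma norm_seq_truncation: "norm_seq (truncation I D A f) = truncation I E A (norm_seq f)"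
  by (rule extensionalityI[of _ I])
    (auto simp: truncation_D_apply truncation_apply truncation_extensional
      normed_space.nrm_zero[OF normed_component])

lemma truncation_D_mem: "f \<in> carrier D \<Longrightarrow> truncation I D A f \<in> carrier D"
  by (simp add: carrier_D norm_seq_truncation truncation_D_extensional truncation_D_apply
      truncation_mem component_rules(1))

lemma vanishing_tails_D: "vanishing_tails I E \<Longrightarrow> vanishing_tails I D"
  by (simp add: vanishing_tails_def nrm_D norm_seq_truncation D_mem)

definition single :: "'i \<Rightarrow> 'a \<Rightarrow> 'i \<Rightarrow> 'a"
  where "single \<alpha> v = (\<lambda>\<beta>\<in>I. if \<beta> = \<alpha> then v else \<zero>\<^bsub>X \<beta>\<^esub>)"

lemma single_mem:
  assumes \<alpha>: "\<alpha> \<in> I" and v: "v \<in> carrier (X \<alpha>)"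
  shows "single \<alpha> v \<in> carrier D"
    and "nrm D (single \<alpha> v) \<le> nrm (X \<alpha>) v * nrm E (\<lambda>\<beta>\<in>I. if \<beta> = \<alpha> then 1 else 0)"
proof -
  let ?e = "\<lambda>\<beta>\<in>I. if \<beta> = \<alpha> then 1 else 0"
  have e: "?e \<in> carrier E" using unit_vector_mem[OF \<alpha>] .
  have *: "single \<alpha> v \<in> extensional I" "\<And>\<beta>. \<beta> \<in> I \<Longrightarrow> single \<alpha> v \<beta> \<in> carrier (X \<beta>)"
    "nrm (X \<alpha>) v \<odot>\<^bsub>E\<^esub> ?e \<in> carrier E"
    "\<And>\<beta>. \<beta> \<in> I \<Longrightarrow> nrm (X \<beta>) (single \<alpha> v \<beta>) \<le> \<bar>(nrm (X \<alpha>) v \<odot>\<^bsub>E\<^esub> ?e) \<beta>\<bar>"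
    using v e by (auto simp: single_def component_rules smult_apply normed_space.nrm_zero[OF normed_component])
  show "single \<alpha> v \<in> carrier D" by (rule dominated(1)[OF *])
  have "nrm D (single \<alpha> v) \<le> nrm E (nrm (X \<alpha>) v \<odot>\<^bsub>E\<^esub> ?e)" by (rule dominated(2)[OF *])
  then show "nrm D (single \<alpha> v) \<le> nrm (X \<alpha>) v * nrm E ?e"
    using nrm_smult[OF e] component_nrm_nonneg[OF \<alpha> v] by simp
qed

lemma single_add: "\<alpha> \<in> I \<Longrightarrow> v \<in> carrier (X \<alpha>) \<Longrightarrow> w \<in> carrier (X \<alpha>) \<Longrightarrow>
    single \<alpha> (v \<oplus>\<^bsub>X \<alpha>\<^esub> w) = single \<alpha> v \<oplus>\<^bsub>D\<^esub> single \<alpha> w"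
  by (rule D_eqI) (auto simp: single_def D_apply D_extensional component_rules)

lemma single_smult: "\<alpha> \<in> I \<Longrightarrow> v \<in> carrier (X \<alpha>) \<Longrightarrow>
    single \<alpha> (a \<odot>\<^bsub>X \<alpha>\<^esub> v) = a \<odot>\<^bsub>D\<^esub> single \<alpha> v"
  by (rule D_eqI) (auto simp: single_def D_apply D_extensional component_rules)

lemma linear_truncation:
  assumes \<psi>: "linear_functional D \<psi>" and f: "f \<in> carrier D" and A: "finite A" "A \<subseteq> I"
  shows "\<psi> (truncation I D A f) = (\<Sum>\<alpha>\<in>A. \<psi> (single \<alpha> (f \<alpha>)))"
  using A
proof (induction A)
  case empty
  have "truncation I D {} f = \<zero>\<^bsub>D\<^esub>"
    by (rule D_eqI) (auto simp: truncation_D_apply truncation_D_extensional D_apply D_extensional)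
  then show ?case using normed_space.linear_zero[OF normed_space_D \<psi>] by simp
next
  case (insert \<alpha> A)
  have "truncation I D (insert \<alpha> A) f = single \<alpha> (f \<alpha>) \<oplus>\<^bsub>D\<^esub> truncation I D A f"
    using insert D_mem[OF f]
    by (intro D_eqI) (auto simp: truncation_D_apply truncation_D_extensional D_apply D_extensional
        single_def component_rules)
  then have "\<psi> (truncation I D (insert \<alpha> A) f) = \<psi> (single \<alpha> (f \<alpha>)) + \<psi> (truncation I D A f)"
    using \<psi> single_mem(1) truncation_D_mem[OF f] D_mem[OF f] insert.prems
    by (simp add: linear_functional_def)
  then show ?case using insert by simp
qed

definition component :: "(('i \<Rightarrow> 'a) \<Rightarrow> real) \<Rightarrow> 'i \<Rightarrow> 'a \<Rightarrow> real"
  where "component \<psi> \<alpha> = (\<lambda>v\<in>carrier (X \<alpha>). \<psi> (single \<alpha> v))"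

lemma component_mem:
  assumes \<psi>: "\<psi> \<in> carrier (dual_space D)" and \<alpha>: "\<alpha> \<in> I"
  shows "component \<psi> \<alpha> \<in> carrier (dual_space (X \<alpha>))"
  unfolding component_def
proof (rule normed_space.dual_memI[OF normed_component[OF \<alpha>]])
  note add = normed_space.dual_add[OF normed_space_D \<psi>]
    and smult = normed_space.dual_smult[OF normed_space_D \<psi>]
  show "linear_functional (X \<alpha>) (\<lambda>v. \<psi> (single \<alpha> v))"
    using \<alpha> by (simp add: linear_functional_def single_add single_smult single_mem add smult)
  fix v assume v: "v \<in> carrier (X \<alpha>)"
  have "\<psi> (single \<alpha> v) \<le> nrm (dual_space D) \<psi> * nrm D (single \<alpha> v)"
    using normed_space.dual_le[OF normed_space_D \<psi> single_mem(1)[OF \<alpha> v]] .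
  also have "\<dots> \<le> nrm (dual_space D) \<psi> * (nrm (X \<alpha>) v * nrm E (\<lambda>\<beta>\<in>I. if \<beta> = \<alpha> then 1 else 0))"
    using single_mem(2)[OF \<alpha> v] normed_space.dual_nrm_nonneg[OF normed_space_D \<psi>]
    by (rule mult_left_mono)
  finally show "\<psi> (single \<alpha> v) \<le>
      nrm (dual_space D) \<psi> * nrm E (\<lambda>\<beta>\<in>I. if \<beta> = \<alpha> then 1 else 0) * nrm (X \<alpha>) v"
    by (simp add: mult_ac)
qed

abbreviation "dual_seq g \<equiv> (\<lambda>\<alpha>\<in>I. nrm (dual_space (X \<alpha>)) (g \<alpha>))"

text \<open>The key estimate.  In each coordinate choose \<open>v\<^sub>\<alpha>\<close> with \<open>\<parallel>v\<^sub>\<alpha>\<parallel> \<le> \<bar>x\<^sub>\<alpha>\<bar>\<close> on which the component of \<open>\<psi>\<close>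
  nearly attains its norm.  The truncation of \<open>v\<close> to \<open>A\<close> has norm at most \<open>\<parallel>x\<parallel>\<close>, and \<open>\<psi>\<close> takes on it
  at least \<open>r\<close> times the sum on the left; then let \<open>r\<close> tend to 1.\<close>
lemma component_norm_estimate:
  assumes \<psi>: "\<psi> \<in> carrier (dual_space D)" and x: "x \<in> carrier E" and A: "finite A" "A \<subseteq> I"
  shows "(\<Sum>\<alpha>\<in>A. \<bar>x \<alpha>\<bar> * nrm (dual_space (X \<alpha>)) (component \<psi> \<alpha>)) \<le> nrm (dual_space D) \<psi> * nrm E x"
proof (rule field_le_mult_one_interval)
  fix r :: real assume r: "0 < r" "r < 1"
  have "\<exists>v. v \<in> carrier (X \<alpha>) \<and> nrm (X \<alpha>) v \<le> \<bar>x \<alpha>\<bar> \<and>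
      r * \<bar>x \<alpha>\<bar> * nrm (dual_space (X \<alpha>)) (component \<psi> \<alpha>) \<le> component \<psi> \<alpha> v" if "\<alpha> \<in> I" for \<alpha>
    by (rule normed_space.dual_nearly_attained[OF normed_component[OF that] component_mem[OF \<psi> that] r
        abs_ge_zero[of "x \<alpha>"]]) blast
  then obtain v where v: "\<And>\<alpha>. \<alpha> \<in> I \<Longrightarrow> v \<alpha> \<in> carrier (X \<alpha>)" "\<And>\<alpha>. \<alpha> \<in> I \<Longrightarrow> nrm (X \<alpha>) (v \<alpha>) \<le> \<bar>x \<alpha>\<bar>"
    "\<And>\<alpha>. \<alpha> \<in> I \<Longrightarrow> r * \<bar>x \<alpha>\<bar> * nrm (dual_space (X \<alpha>)) (component \<psi> \<alpha>) \<le> component \<psi> \<alpha> (v \<alpha>)"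
    by metis
  let ?f = "restrict v I"
  have f: "?f \<in> carrier D" "nrm D ?f \<le> nrm E x"
    by (rule dominated[OF _ _ x]; use v in auto)+
  have tf: "nrm D (truncation I D A ?f) \<le> nrm D ?f"
    using truncation_nrm_le[OF D_mem(1)[OF f(1)]] by (simp add: nrm_D norm_seq_truncation)
  have "r * (\<Sum>\<alpha>\<in>A. \<bar>x \<alpha>\<bar> * nrm (dual_space (X \<alpha>)) (component \<psi> \<alpha>)) \<le> (\<Sum>\<alpha>\<in>A. component \<psi> \<alpha> (v \<alpha>))"
    unfolding sum_distrib_left using A v(3) by (intro sum_mono) (auto simp: mult.assoc)
  also have "\<dots> = (\<Sum>\<alpha>\<in>A. \<psi> (single \<alpha> (?f \<alpha>)))"
    using A v(1) by (intro sum.cong) (auto simp: component_def)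
  also have "\<dots> = \<psi> (truncation I D A ?f)"
    using linear_truncation[OF normed_space.dual_linear[OF normed_space_D \<psi>] f(1) A] by simp
  also have "\<dots> \<le> nrm (dual_space D) \<psi> * nrm D (truncation I D A ?f)"
    by (rule normed_space.dual_le[OF normed_space_D \<psi> truncation_D_mem[OF f(1)]])
  also have "\<dots> \<le> nrm (dual_space D) \<psi> * nrm E x"
    using tf f(2) normed_space.dual_nrm_nonneg[OF normed_space_D \<psi>] by (intro mult_left_mono) auto
  finally show "r * (\<Sum>\<alpha>\<in>A. \<bar>x \<alpha>\<bar> * nrm (dual_space (X \<alpha>)) (component \<psi> \<alpha>))
      \<le> nrm (dual_space D) \<psi> * nrm E x" .
qed

lemma component_norms_kothe:
  assumes \<psi>: "\<psi> \<in> carrier (dual_space D)"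
  shows "dual_seq (component \<psi>) \<in> carrier (kothe_dual I E)"
    and "nrm (kothe_dual I E) (dual_seq (component \<psi>)) \<le> nrm (dual_space D) \<psi>"
proof -
  have "(\<Sum>\<alpha>\<in>A. \<bar>x \<alpha>\<bar> * \<bar>dual_seq (component \<psi>) \<alpha>\<bar>) \<le> nrm (dual_space D) \<psi> * nrm E x"
    if "x \<in> carrier E" "finite A" "A \<subseteq> I" for x A
  proof -
    have "(\<Sum>\<alpha>\<in>A. \<bar>x \<alpha>\<bar> * \<bar>dual_seq (component \<psi>) \<alpha>\<bar>) =
        (\<Sum>\<alpha>\<in>A. \<bar>x \<alpha>\<bar> * nrm (dual_space (X \<alpha>)) (component \<psi> \<alpha>))"
      using that normed_space.dual_nrm_nonneg[OF normed_component component_mem[OF \<psi>]]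
      by (intro sum.cong) auto
    then show ?thesis using component_norm_estimate[OF \<psi> that] by simp
  qed
  note * = kothe_memI[OF restrict_extensional normed_space.dual_nrm_nonneg[OF normed_space_D \<psi>] this]
  show "dual_seq (component \<psi>) \<in> carrier (kothe_dual I E)" by (rule *(1))
  show "nrm (kothe_dual I E) (dual_seq (component \<psi>)) \<le> nrm (dual_space D) \<psi>" by (rule *(2))
qed

section \<open>The dual of a direct sum\<close>

lemma truncation_D_split: "f \<in> carrier D \<Longrightarrow> f = truncation I D A f \<oplus>\<^bsub>D\<^esub> truncation I D (- A) f"
  by (rule D_eqI) (auto simp: truncation_D_apply D_extensional D_apply D_mem component_rules)

lemma truncation_D_nrm_le: "f \<in> carrier D \<Longrightarrow> nrm D (truncation I D A f) \<le> nrm D f"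
  using truncation_nrm_le[OF D_mem(1)] by (simp add: nrm_D norm_seq_truncation)

text \<open>The partial sums are the values of \<open>\<psi>\<close> at the truncations of \<open>f\<close>, which converge to \<open>f\<close>.\<close>
lemma component_has_sum:
  assumes tails: "vanishing_tails I E" and \<psi>: "\<psi> \<in> carrier (dual_space D)" and f: "f \<in> carrier D"
  shows "((\<lambda>\<alpha>. component \<psi> \<alpha> (f \<alpha>)) has_sum \<psi> f) I"
proof -
  let ?G = "finite_subsets_at_top I"
  have lin: "linear_functional D \<psi>" using normed_space.dual_linear[OF normed_space_D \<psi>] .
  have diff: "norm (\<psi> (truncation I D A f) - \<psi> f) \<le> nrm (dual_space D) \<psi> * nrm D (truncation I D (- A) f)" for A
  proof -
    have "\<psi> f = \<psi> (truncation I D A f) + \<psi> (truncation I D (- A) f)"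
      using lin truncation_D_split[OF f, of A] truncation_D_mem[OF f] unfolding linear_functional_def by metis
    then show ?thesis
      using normed_space.dual_abs_le[OF normed_space_D \<psi> truncation_D_mem[OF f]] by simp
  qed
  have "((\<lambda>A. nrm D (truncation I D (- A) f)) \<longlongrightarrow> 0) ?G"
    using vanishing_tails_D[OF tails] f by (simp add: vanishing_tails_def)
  then have "((\<lambda>A. nrm (dual_space D) \<psi> * nrm D (truncation I D (- A) f)) \<longlongrightarrow> 0) ?G"
    by (rule tendsto_mult_right_zero)
  then have "((\<lambda>A. \<psi> (truncation I D A f) - \<psi> f) \<longlongrightarrow> 0) ?G"
    by (rule Lim_null_comparison[rotated]) (intro always_eventually allI diff)
  then have "((\<lambda>A. \<psi> (truncation I D A f)) \<longlongrightarrow> \<psi> f) ?G" by (rule LIM_zero_cancel)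
  moreover have "\<forall>\<^sub>F A in ?G. \<psi> (truncation I D A f) = (\<Sum>\<alpha>\<in>A. component \<psi> \<alpha> (f \<alpha>))"
  proof (rule eventually_finite_subsets_at_top_weakI)
    fix A assume A: "finite A" "A \<subseteq> I"
    then have "(\<Sum>\<alpha>\<in>A. component \<psi> \<alpha> (f \<alpha>)) = (\<Sum>\<alpha>\<in>A. \<psi> (single \<alpha> (f \<alpha>)))"
      using D_mem[OF f] by (intro sum.cong) (auto simp: component_def)
    then show "\<psi> (truncation I D A f) = (\<Sum>\<alpha>\<in>A. component \<psi> \<alpha> (f \<alpha>))"
      using linear_truncation[OF lin f A] by simp
  qed
  ultimately show ?thesis unfolding has_sum_def by (rule Lim_transform_eventually)
qed

abbreviation "D' \<equiv> direct_sum I (kothe_dual I E) (\<lambda>\<alpha>. dual_space (X \<alpha>))"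

definition pairing :: "('i \<Rightarrow> 'a \<Rightarrow> real) \<Rightarrow> ('i \<Rightarrow> 'a) \<Rightarrow> real"
  where "pairing g = (\<lambda>f\<in>carrier D. \<Sum>\<^sub>\<infinity>\<alpha>\<in>I. g \<alpha> (f \<alpha>))"

lemma carrier_D': "g \<in> carrier D' \<longleftrightarrow> g \<in> extensional I \<and>
    (\<forall>\<alpha>\<in>I. g \<alpha> \<in> carrier (dual_space (X \<alpha>))) \<and> dual_seq g \<in> carrier (kothe_dual I E)"
  by (auto simp: direct_sum_def PiE_iff)

lemma nrm_D': "nrm D' g = nrm (kothe_dual I E) (dual_seq g)"
  by (simp add: direct_sum_def)

text \<open>Hoelder's inequality: \<open>\<bar>g\<^sub>\<alpha> (f\<^sub>\<alpha>)\<bar> \<le> \<parallel>f\<^sub>\<alpha>\<parallel> \<parallel>g\<^sub>\<alpha>\<parallel>\<close>, and the norm sequences lie in \<open>E\<close> and its Koethe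
  dual.\<close>
lemma pairing_summable:
  assumes g: "g \<in> carrier D'" and f: "f \<in> carrier D"
  shows "(\<lambda>\<alpha>. g \<alpha> (f \<alpha>)) summable_on I"
    and "(\<Sum>\<^sub>\<infinity>\<alpha>\<in>I. g \<alpha> (f \<alpha>)) \<le> nrm D' g * nrm D f"
proof -
  let ?b = "\<lambda>\<alpha>. norm_seq f \<alpha> * dual_seq g \<alpha>"
  have y: "dual_seq g \<in> carrier (kothe_dual I E)" using g by (simp add: carrier_D')
  have b: "?b summable_on I" using kothe_summable[OF y D_mem(1)[OF f]] .
  have le: "\<bar>g \<alpha> (f \<alpha>)\<bar> \<le> ?b \<alpha>" if "\<alpha> \<in> I" for \<alpha>
    using normed_space.dual_abs_le[OF normed_component[OF that], of "g \<alpha>" "f \<alpha>"] that g D_mem[OF f]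
    by (simp add: carrier_D' mult.commute)
  have "(\<lambda>\<alpha>. \<bar>g \<alpha> (f \<alpha>)\<bar>) summable_on I"
    by (rule summable_on_comparison_test[OF b]) (use le in auto)
  then show summable: "(\<lambda>\<alpha>. g \<alpha> (f \<alpha>)) summable_on I"
    by (subst summable_on_iff_abs_summable_on_real) simp
  have "(\<Sum>\<^sub>\<infinity>\<alpha>\<in>I. g \<alpha> (f \<alpha>)) \<le> (\<Sum>\<^sub>\<infinity>\<alpha>\<in>I. ?b \<alpha>)"
    by (rule infsum_mono[OF summable b]) (use le abs_le_D1 in blast)
  also have "\<dots> \<le> nrm (kothe_dual I E) (dual_seq g) * nrm E (norm_seq f)"
    by (rule kothe_infsum_le[OF y D_mem(1)[OF f]])
  finally show "(\<Sum>\<^sub>\<infinity>\<alpha>\<in>I. g \<alpha> (f \<alpha>)) \<le> nrm D' g * nrm D f" by (simp only: nrm_D' nrm_D)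
qed

lemma pairing_mem:
  assumes g: "g \<in> carrier D'"
  shows "pairing g \<in> carrier (dual_space D)"
  unfolding pairing_def
proof (rule normed_space.dual_memI[OF normed_space_D])
  have g': "g \<alpha> \<in> carrier (dual_space (X \<alpha>))" if "\<alpha> \<in> I" for \<alpha> using g that by (simp add: carrier_D')
  show "linear_functional D (\<lambda>f. \<Sum>\<^sub>\<infinity>\<alpha>\<in>I. g \<alpha> (f \<alpha>))"
    unfolding linear_functional_def
  proof (intro conjI ballI allI)
    fix f h assume fh: "f \<in> carrier D" "h \<in> carrier D"
    have "(\<Sum>\<^sub>\<infinity>\<alpha>\<in>I. g \<alpha> ((f \<oplus>\<^bsub>D\<^esub> h) \<alpha>)) = (\<Sum>\<^sub>\<infinity>\<alpha>\<in>I. g \<alpha> (f \<alpha>) + g \<alpha> (h \<alpha>))"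
      using D_mem(2)[OF fh(1)] D_mem(2)[OF fh(2)]
      by (intro infsum_cong) (simp add: D_apply normed_space.dual_add[OF normed_component g'])
    also have "\<dots> = (\<Sum>\<^sub>\<infinity>\<alpha>\<in>I. g \<alpha> (f \<alpha>)) + (\<Sum>\<^sub>\<infinity>\<alpha>\<in>I. g \<alpha> (h \<alpha>))"
      using pairing_summable(1)[OF g] fh by (intro infsum_add)
    finally show "(\<Sum>\<^sub>\<infinity>\<alpha>\<in>I. g \<alpha> ((f \<oplus>\<^bsub>D\<^esub> h) \<alpha>)) = (\<Sum>\<^sub>\<infinity>\<alpha>\<in>I. g \<alpha> (f \<alpha>)) + (\<Sum>\<^sub>\<infinity>\<alpha>\<in>I. g \<alpha> (h \<alpha>))" .
  next
    fix a f assume f: "f \<in> carrier D"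
    have "(\<Sum>\<^sub>\<infinity>\<alpha>\<in>I. g \<alpha> ((a \<odot>\<^bsub>D\<^esub> f) \<alpha>)) = (\<Sum>\<^sub>\<infinity>\<alpha>\<in>I. a * g \<alpha> (f \<alpha>))"
      using D_mem(2)[OF f]
      by (intro infsum_cong) (simp add: D_apply normed_space.dual_smult[OF normed_component g'])
    also have "\<dots> = a * (\<Sum>\<^sub>\<infinity>\<alpha>\<in>I. g \<alpha> (f \<alpha>))" by (rule infsum_cmult_right')
    finally show "(\<Sum>\<^sub>\<infinity>\<alpha>\<in>I. g \<alpha> ((a \<odot>\<^bsub>D\<^esub> f) \<alpha>)) = a * (\<Sum>\<^sub>\<infinity>\<alpha>\<in>I. g \<alpha> (f \<alpha>))" .
  qed
qed (rule pairing_summable(2)[OF g])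

text \<open>Components invert the pairing.  This yields injectivity and, through the key estimate, the lower
  bound for the norm of a pairing.\<close>
lemma component_pairing:
  assumes g: "g \<in> carrier D'" and \<alpha>: "\<alpha> \<in> I"
  shows "component (pairing g) \<alpha> = g \<alpha>"
proof (rule extensionalityI[of _ "carrier (X \<alpha>)"])
  have g': "g \<beta> \<in> carrier (dual_space (X \<beta>))" if "\<beta> \<in> I" for \<beta> using g that by (simp add: carrier_D')
  then show "g \<alpha> \<in> extensional (carrier (X \<alpha>))"
    using normed_space.dual_extensional[OF normed_component] \<alpha> by blast
  fix v assume v: "v \<in> carrier (X \<alpha>)"
  have "((\<lambda>\<beta>. g \<beta> (single \<alpha> v \<beta>)) has_sum g \<alpha> v) I"
  proof (rule has_sum_finite_neutralI[of "{\<alpha>}"])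
    show "g \<beta> (single \<alpha> v \<beta>) = 0" if "\<beta> \<in> I - {\<alpha>}" for \<beta>
      using that normed_space.linear_zero[OF normed_component normed_space.dual_linear[OF normed_component g']]
      by (simp add: single_def)
  qed (use \<alpha> in \<open>auto simp: single_def\<close>)
  then show "component (pairing g) \<alpha> v = g \<alpha> v"
    using v single_mem(1)[OF \<alpha> v] by (simp add: component_def pairing_def infsumI)
qed (simp add: component_def)

lemma dual_seq_component_pairing: "g \<in> carrier D' \<Longrightarrow> dual_seq (component (pairing g)) = dual_seq g"
  by (auto simp: component_pairing fun_eq_iff)

theorem pairing_isometric_isomorphism:
  assumes tails: "vanishing_tails I E"
  shows "isometric_isomorphism D' (dual_space D) pairing"
  unfolding isometric_isomorphism_def
proof (intro conjI ballI allI)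
  have surj: "\<exists>g\<in>carrier D'. pairing g = \<psi>" if \<psi>: "\<psi> \<in> carrier (dual_space D)" for \<psi>
  proof (rule bexI)
    let ?g = "restrict (component \<psi>) I"
    show "?g \<in> carrier D'"
      using component_mem[OF \<psi>] component_norms_kothe(1)[OF \<psi>] by (simp add: carrier_D' cong: restrict_cong)
    show "pairing ?g = \<psi>"
    proof (rule extensionalityI[of _ "carrier D"])
      fix f assume f: "f \<in> carrier D"
      have "(\<Sum>\<^sub>\<infinity>\<alpha>\<in>I. ?g \<alpha> (f \<alpha>)) = (\<Sum>\<^sub>\<infinity>\<alpha>\<in>I. component \<psi> \<alpha> (f \<alpha>))"
        by (intro infsum_cong) simp
      then show "pairing ?g f = \<psi> f"
        using infsumI[OF component_has_sum[OF tails \<psi> f]] f by (simp add: pairing_def)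
    qed (use normed_space.dual_extensional[OF normed_space_D \<psi>] in \<open>auto simp: pairing_def\<close>)
  qed
  have inj: "g = h" if "g \<in> carrier D'" "h \<in> carrier D'" "pairing g = pairing h" for g h
  proof (rule D_eqI)
    show "g \<alpha> = h \<alpha>" if "\<alpha> \<in> I" for \<alpha>
      using component_pairing[OF _ that, of g] component_pairing[OF _ that, of h]
        \<open>g \<in> carrier D'\<close> \<open>h \<in> carrier D'\<close> \<open>pairing g = pairing h\<close> by simp
  qed (use that in \<open>auto simp: carrier_D'\<close>)
  show "bij_betw pairing (carrier D') (carrier (dual_space D))"
    unfolding bij_betw_def using surj inj pairing_mem by (blast intro: inj_onI)
next
  fix g h assume gh: "g \<in> carrier D'" "h \<in> carrier D'"
  have "pairing (g \<oplus>\<^bsub>D'\<^esub> h) f = pairing g f + pairing h f" if f: "f \<in> carrier D" for f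
  proof -
    have "(\<Sum>\<^sub>\<infinity>\<alpha>\<in>I. (g \<oplus>\<^bsub>D'\<^esub> h) \<alpha> (f \<alpha>)) = (\<Sum>\<^sub>\<infinity>\<alpha>\<in>I. g \<alpha> (f \<alpha>) + h \<alpha> (f \<alpha>))"
      using D_mem(2)[OF f] by (intro infsum_cong) (simp add: direct_sum_def dual_space_def)
    then show ?thesis
      using infsum_add[OF pairing_summable(1)[OF gh(1) f] pairing_summable(1)[OF gh(2) f]] f
      by (simp add: pairing_def)
  qed
  then show "pairing (g \<oplus>\<^bsub>D'\<^esub> h) = pairing g \<oplus>\<^bsub>dual_space D\<^esub> pairing h"
    by (intro extensionalityI[of _ "carrier D"]) (auto simp: pairing_def dual_space_def)
next
  fix a g assume g: "g \<in> carrier D'"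
  have "pairing (a \<odot>\<^bsub>D'\<^esub> g) f = a * pairing g f" if f: "f \<in> carrier D" for f
  proof -
    have "(\<Sum>\<^sub>\<infinity>\<alpha>\<in>I. (a \<odot>\<^bsub>D'\<^esub> g) \<alpha> (f \<alpha>)) = (\<Sum>\<^sub>\<infinity>\<alpha>\<in>I. a * g \<alpha> (f \<alpha>))"
      using D_mem(2)[OF f] by (intro infsum_cong) (simp add: direct_sum_def dual_space_def)
    then show ?thesis using f by (simp add: pairing_def infsum_cmult_right')
  qed
  then show "pairing (a \<odot>\<^bsub>D'\<^esub> g) = a \<odot>\<^bsub>dual_space D\<^esub> pairing g"
    by (intro extensionalityI[of _ "carrier D"]) (auto simp: pairing_def dual_space_def)
next
  fix g assume g: "g \<in> carrier D'"
  have "0 \<le> nrm D' g" using kothe_nrm_nonneg g by (simp add: carrier_D' nrm_D')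
  then have "nrm (dual_space D) (pairing g) \<le> nrm D' g"
    using pairing_summable(2)[OF g] normed_space.dual_linear[OF normed_space_D pairing_mem[OF g]]
    by (intro normed_space.dual_norm_le[OF normed_space_D]) (auto simp: pairing_def)
  moreover have "nrm D' g \<le> nrm (dual_space D) (pairing g)"
    using component_norms_kothe(2)[OF pairing_mem[OF g]] dual_seq_component_pairing[OF g]
    by (simp add: nrm_D')
  ultimately show "nrm (dual_space D) (pairing g) = nrm D' g" by simp
qed

section \<open>Reflexivity of direct sums\<close>

text \<open>The transpose of the projection of the direct sum to its coordinate \<open>\<alpha>\<close>.\<close>
definition lift :: "'i \<Rightarrow> ('a \<Rightarrow> real) \<Rightarrow> ('i \<Rightarrow> 'a) \<Rightarrow> real"
  where "lift \<alpha> h = (\<lambda>f\<in>carrier D. h (f \<alpha>))"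

lemma lift_bound:
  assumes \<alpha>: "\<alpha> \<in> I"
  obtains C where "0 \<le> C" "\<And>h. h \<in> carrier (dual_space (X \<alpha>)) \<Longrightarrow> lift \<alpha> h \<in> carrier (dual_space D) \<and>
    nrm (dual_space D) (lift \<alpha> h) \<le> C * nrm (dual_space (X \<alpha>)) h"
proof -
  interpret Xa: normed_space "X \<alpha>" by (rule normed_component[OF \<alpha>])
  interpret Ds: normed_space D by (rule normed_space_D)
  obtain C0 where C0: "\<And>x. x \<in> carrier E \<Longrightarrow> \<bar>x \<alpha>\<bar> \<le> C0 * nrm E x" using coordinate_bound[OF \<alpha>] by blast
  have C: "nrm (X \<alpha>) (f \<alpha>) \<le> \<bar>C0\<bar> * nrm D f" if f: "f \<in> carrier D" for f
  proof -
    have "nrm (X \<alpha>) (f \<alpha>) \<le> C0 * nrm D f" using C0[OF D_mem(1)[OF f]] \<alpha> by (simp add: nrm_D)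
    also have "\<dots> \<le> \<bar>C0\<bar> * nrm D f" using Ds.nrm_nonneg[OF f] by (intro mult_right_mono) auto
    finally show ?thesis .
  qed
  have *: "lift \<alpha> h \<in> carrier (dual_space D) \<and>
    nrm (dual_space D) (lift \<alpha> h) \<le> \<bar>C0\<bar> * nrm (dual_space (X \<alpha>)) h"
    if h: "h \<in> carrier (dual_space (X \<alpha>))" for h
  proof -
    have le: "h (f \<alpha>) \<le> \<bar>C0\<bar> * nrm (dual_space (X \<alpha>)) h * nrm D f" if f: "f \<in> carrier D" for f
    proof -
      have "h (f \<alpha>) \<le> nrm (dual_space (X \<alpha>)) h * nrm (X \<alpha>) (f \<alpha>)"
        using Xa.dual_le[OF h D_mem(2)[OF f \<alpha>]] .
      also have "\<dots> \<le> nrm (dual_space (X \<alpha>)) h * (\<bar>C0\<bar> * nrm D f)"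
        using C[OF f] Xa.dual_nrm_nonneg[OF h] by (rule mult_left_mono)
      finally show ?thesis by (simp add: mult_ac)
    qed
    have "linear_functional D (\<lambda>f. h (f \<alpha>))"
      using \<alpha> D_mem(2) by (simp add: linear_functional_def D_apply Xa.dual_add[OF h] Xa.dual_smult[OF h])
    then have mem: "lift \<alpha> h \<in> carrier (dual_space D)"
      unfolding lift_def using le by (rule Ds.dual_memI)
    moreover have "nrm (dual_space D) (lift \<alpha> h) \<le> \<bar>C0\<bar> * nrm (dual_space (X \<alpha>)) h"
      using le Xa.dual_nrm_nonneg[OF h]
      by (intro Ds.dual_norm_le Ds.dual_linear[OF mem]) (auto simp: lift_def)
    ultimately show ?thesis by blast
  qed
  show thesis by (rule that[OF abs_ge_zero *])
qed

lemma lift_mem: "\<alpha> \<in> I \<Longrightarrow> h \<in> carrier (dual_space (X \<alpha>)) \<Longrightarrow> lift \<alpha> h \<in> carrier (dual_space D)"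
  using lift_bound by blast

lemma lift_linear:
  assumes \<alpha>: "\<alpha> \<in> I" and \<Phi>: "linear_functional (dual_space D) \<Phi>"
  shows "linear_functional (dual_space (X \<alpha>)) (\<lambda>h. \<Phi> (lift \<alpha> h))"
  unfolding linear_functional_def
proof (intro conjI ballI allI)
  fix h k assume hk: "h \<in> carrier (dual_space (X \<alpha>))" "k \<in> carrier (dual_space (X \<alpha>))"
  have "lift \<alpha> (h \<oplus>\<^bsub>dual_space (X \<alpha>)\<^esub> k) = lift \<alpha> h \<oplus>\<^bsub>dual_space D\<^esub> lift \<alpha> k"
    using \<alpha> D_mem(2) by (intro extensionalityI[of _ "carrier D"]) (auto simp: lift_def dual_space_def)
  then show "\<Phi> (lift \<alpha> (h \<oplus>\<^bsub>dual_space (X \<alpha>)\<^esub> k)) = \<Phi> (lift \<alpha> h) + \<Phi> (lift \<alpha> k)"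
    using \<Phi> lift_mem[OF \<alpha>] hk by (simp add: linear_functional_def)
next
  fix a h assume h: "h \<in> carrier (dual_space (X \<alpha>))"
  have "lift \<alpha> (a \<odot>\<^bsub>dual_space (X \<alpha>)\<^esub> h) = a \<odot>\<^bsub>dual_space D\<^esub> lift \<alpha> h"
    using \<alpha> D_mem(2) by (intro extensionalityI[of _ "carrier D"]) (auto simp: lift_def dual_space_def)
  then show "\<Phi> (lift \<alpha> (a \<odot>\<^bsub>dual_space (X \<alpha>)\<^esub> h)) = a * \<Phi> (lift \<alpha> h)"
    using \<Phi> lift_mem[OF \<alpha>] h by (simp add: linear_functional_def)
qed

text \<open>Composed with the transposed projection, \<open>\<Phi>\<close> becomes an element of the bidual of \<open>X\<^sub>\<alpha>\<close>, hence an
  evaluation.\<close>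
lemma bidual_coordinates:
  assumes refl: "\<And>\<alpha>. \<alpha> \<in> I \<Longrightarrow> reflexive_space (X \<alpha>)"
    and \<Phi>: "\<Phi> \<in> carrier (dual_space (dual_space D))"
  obtains x where "\<And>\<alpha>. \<alpha> \<in> I \<Longrightarrow> x \<alpha> \<in> carrier (X \<alpha>)"
    "\<And>\<alpha> h. \<alpha> \<in> I \<Longrightarrow> h \<in> carrier (dual_space (X \<alpha>)) \<Longrightarrow> \<Phi> (lift \<alpha> h) = h (x \<alpha>)"
proof -
  interpret DD: normed_space "dual_space D"
    by (rule normed_space.normed_space_dual[OF normed_space_D])
  have "\<exists>v. v \<in> carrier (X \<alpha>) \<and> (\<forall>h\<in>carrier (dual_space (X \<alpha>)). \<Phi> (lift \<alpha> h) = h v)" if \<alpha>: "\<alpha> \<in> I" for \<alpha>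
  proof -
    obtain C where C: "\<And>h. h \<in> carrier (dual_space (X \<alpha>)) \<Longrightarrow>
        lift \<alpha> h \<in> carrier (dual_space D) \<and> nrm (dual_space D) (lift \<alpha> h) \<le> C * nrm (dual_space (X \<alpha>)) h"
      using lift_bound[OF \<alpha>] by metis
    have le: "\<Phi> (lift \<alpha> h) \<le> nrm (dual_space (dual_space D)) \<Phi> * C * nrm (dual_space (X \<alpha>)) h"
      if h: "h \<in> carrier (dual_space (X \<alpha>))" for h
    proof -
      have "\<Phi> (lift \<alpha> h) \<le> nrm (dual_space (dual_space D)) \<Phi> * nrm (dual_space D) (lift \<alpha> h)"
        using DD.dual_le[OF \<Phi>] C[OF h] by blast
      also have "\<dots> \<le> nrm (dual_space (dual_space D)) \<Phi> * (C * nrm (dual_space (X \<alpha>)) h)"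
        using C[OF h] DD.dual_nrm_nonneg[OF \<Phi>] by (intro mult_left_mono) auto
      finally show ?thesis by (simp add: mult.assoc)
    qed
    show ?thesis
      by (rule normed_space.reflexive_bidual[OF normed_component[OF \<alpha>] refl[OF \<alpha>]
          lift_linear[OF \<alpha> DD.dual_linear[OF \<Phi>]] le]) blast+
  qed
  then show thesis using that by metis
qed

lemma bidual_finite_sum:
  assumes \<Phi>: "linear_functional (dual_space D) \<Phi>" and A: "finite A" "A \<subseteq> I"
    and h: "\<And>\<alpha>. \<alpha> \<in> I \<Longrightarrow> h \<alpha> \<in> carrier (dual_space (X \<alpha>))"
  shows "(\<lambda>f\<in>carrier D. \<Sum>\<alpha>\<in>A. h \<alpha> (f \<alpha>)) \<in> carrier (dual_space D) \<and>
    \<Phi> (\<lambda>f\<in>carrier D. \<Sum>\<alpha>\<in>A. h \<alpha> (f \<alpha>)) = (\<Sum>\<alpha>\<in>A. \<Phi> (lift \<alpha> (h \<alpha>)))"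
  using A
proof (induction A)
  interpret DD: normed_space "dual_space D"
    by (rule normed_space.normed_space_dual[OF normed_space_D])
  case empty
  have "(\<lambda>f\<in>carrier D. \<Sum>\<alpha>\<in>{}. h \<alpha> (f \<alpha>)) = \<zero>\<^bsub>dual_space D\<^esub>" by (simp add: dual_space_def)
  then show ?case using DD.linear_zero[OF \<Phi>] DD.M.zero_closed by simp
next
  interpret DD: normed_space "dual_space D"
    by (rule normed_space.normed_space_dual[OF normed_space_D])
  case (insert \<alpha> A)
  let ?\<psi> = "\<lambda>f\<in>carrier D. \<Sum>\<alpha>\<in>A. h \<alpha> (f \<alpha>)"
  have \<psi>: "?\<psi> \<in> carrier (dual_space D)" and l: "lift \<alpha> (h \<alpha>) \<in> carrier (dual_space D)"
    using insert.IH insert.prems lift_mem h by blast+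
  have \<Phi>\<psi>: "\<Phi> ?\<psi> = (\<Sum>\<alpha>\<in>A. \<Phi> (lift \<alpha> (h \<alpha>)))" using insert.IH insert.prems by blast
  have "(\<lambda>f\<in>carrier D. \<Sum>\<alpha>\<in>insert \<alpha> A. h \<alpha> (f \<alpha>)) = lift \<alpha> (h \<alpha>) \<oplus>\<^bsub>dual_space D\<^esub> ?\<psi>"
    using insert.hyps by (auto simp: lift_def dual_space_def fun_eq_iff)
  moreover have "\<Phi> (lift \<alpha> (h \<alpha>) \<oplus>\<^bsub>dual_space D\<^esub> ?\<psi>) = \<Phi> (lift \<alpha> (h \<alpha>)) + \<Phi> ?\<psi>"
    using \<Phi> \<psi> l unfolding linear_functional_def by blast
  moreover have "lift \<alpha> (h \<alpha>) \<oplus>\<^bsub>dual_space D\<^esub> ?\<psi> \<in> carrier (dual_space D)"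
    using l \<psi> by (rule DD.M.a_closed)
  ultimately show ?case using \<Phi>\<psi> by (simp only: sum.insert[OF insert.hyps] simp_thms)
qed

text \<open>Let \<open>u\<^sub>A\<close> be the truncation of \<open>(\<parallel>x\<^sub>\<alpha>\<parallel>)\<close> to a finite set \<open>A\<close> and \<open>\<theta>\<close> a functional norming it.  With
  \<open>h\<^sub>\<alpha>\<close> norming \<open>x\<^sub>\<alpha>\<close> and \<open>e\<^sub>\<alpha>\<close> the unit vectors, \<open>\<psi> f = \<Sum>\<^sub>\<alpha>\<^sub>\<in>\<^sub>A \<theta> e\<^sub>\<alpha> h\<^sub>\<alpha> (f\<^sub>\<alpha>)\<close> is \<open>\<theta>\<close> applied to the
  truncation of \<open>(h\<^sub>\<alpha> (f\<^sub>\<alpha>))\<close>, so it has norm at most 1, while \<open>\<Phi> \<psi> = \<theta> u\<^sub>A = \<parallel>u\<^sub>A\<parallel>\<close>.  Thus \<open>\<parallel>u\<^sub>A\<parallel> \<le> \<parallel>\<Phi>\<parallel>\<close>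
  for all \<open>A\<close>, and the cluster point of this net in \<open>E\<close> is \<open>(\<parallel>x\<^sub>\<alpha>\<parallel>)\<close>.\<close>
lemma bidual_coordinates_mem:
  assumes refl: "reflexive_space E" and \<Phi>: "\<Phi> \<in> carrier (dual_space (dual_space D))"
    and x: "\<And>\<alpha>. \<alpha> \<in> I \<Longrightarrow> x \<alpha> \<in> carrier (X \<alpha>)"
    and eval: "\<And>\<alpha> h. \<alpha> \<in> I \<Longrightarrow> h \<in> carrier (dual_space (X \<alpha>)) \<Longrightarrow> \<Phi> (lift \<alpha> h) = h (x \<alpha>)"
  shows "restrict x I \<in> carrier D"
proof -
  interpret Ds: normed_space D by (rule normed_space_D)
  interpret DD: normed_space "dual_space D" by (rule Ds.normed_space_dual)
  let ?G = "finite_subsets_at_top I"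
  define u where "u A = truncation I E (A \<inter> I) (norm_seq x)" for A
  have u: "u A = (\<lambda>\<alpha>\<in>I. if \<alpha> \<in> A \<inter> I then nrm (X \<alpha>) (x \<alpha>) else 0)" for A
    by (auto simp: u_def truncation_def zero_apply fun_eq_iff)
  obtain h where h: "\<And>\<alpha>. \<alpha> \<in> I \<Longrightarrow> h \<alpha> \<in> carrier (dual_space (X \<alpha>))"
    "\<And>\<alpha> v. \<alpha> \<in> I \<Longrightarrow> v \<in> carrier (X \<alpha>) \<Longrightarrow> \<bar>h \<alpha> v\<bar> \<le> nrm (X \<alpha>) v"
    "\<And>\<alpha>. \<alpha> \<in> I \<Longrightarrow> h \<alpha> (x \<alpha>) = nrm (X \<alpha>) (x \<alpha>)"
  proof -
    have "\<exists>k. k \<in> carrier (dual_space (X \<alpha>)) \<and> (\<forall>v\<in>carrier (X \<alpha>). \<bar>k v\<bar> \<le> nrm (X \<alpha>) v) \<and>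
        k (x \<alpha>) = nrm (X \<alpha>) (x \<alpha>)" if "\<alpha> \<in> I" for \<alpha>
      by (rule normed_space.norming_functional[OF normed_component[OF that] x[OF that]]) blast
    then show thesis using that by metis
  qed
  have bound: "u A \<in> carrier E \<and> nrm E (u A) \<le> nrm (dual_space (dual_space D)) \<Phi>" if A: "finite (A \<inter> I)" for A
  proof -
    let ?e = "\<lambda>\<alpha>. \<lambda>\<beta>\<in>I. if \<beta> = \<alpha> then 1 else 0 :: real"
    have "linear_functional E (\<lambda>x. 0)" by (simp add: linear_functional_def)
    then have mem: "u A \<in> carrier E" using linear_finitely_supported[OF _ A] by (simp add: u)
    obtain \<theta> where \<theta>: "\<theta> \<in> carrier (dual_space E)" "\<And>y. y \<in> carrier E \<Longrightarrow> \<bar>\<theta> y\<bar> \<le> nrm E y"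
      "\<theta> (u A) = nrm E (u A)"
      using norming_functional[OF mem] by blast
    note expand = linear_finitely_supported[OF dual_linear[OF \<theta>(1)] A Int_lower2]
    let ?k = "\<lambda>\<alpha>. \<theta> (?e \<alpha>) \<odot>\<^bsub>dual_space (X \<alpha>)\<^esub> h \<alpha>"
    let ?\<psi> = "\<lambda>f\<in>carrier D. \<Sum>\<alpha>\<in>A \<inter> I. ?k \<alpha> (f \<alpha>)"
    have k: "?k \<alpha> \<in> carrier (dual_space (X \<alpha>))" "\<And>v. v \<in> carrier (X \<alpha>) \<Longrightarrow> ?k \<alpha> v = \<theta> (?e \<alpha>) * h \<alpha> v"
      if "\<alpha> \<in> I" for \<alpha>
    proof -
      interpret Xd: normed_space "dual_space (X \<alpha>)"
        by (rule normed_space.normed_space_dual[OF normed_component[OF that]])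
      show "?k \<alpha> \<in> carrier (dual_space (X \<alpha>))" using h(1)[OF that] by simp
      show "?k \<alpha> v = \<theta> (?e \<alpha>) * h \<alpha> v" if "v \<in> carrier (X \<alpha>)" for v using that by (simp add: dual_space_def)
    qed
    have \<psi>: "?\<psi> \<in> carrier (dual_space D)" "\<Phi> ?\<psi> = (\<Sum>\<alpha>\<in>A \<inter> I. \<Phi> (lift \<alpha> (?k \<alpha>)))"
      using bidual_finite_sum[OF DD.dual_linear[OF \<Phi>] A _ k(1)] by auto
    have "\<Phi> ?\<psi> = nrm E (u A)"
    proof -
      have "\<Phi> ?\<psi> = (\<Sum>\<alpha>\<in>A \<inter> I. nrm (X \<alpha>) (x \<alpha>) * \<theta> (?e \<alpha>))"
        unfolding \<psi>(2) by (intro sum.cong) (auto simp: eval k x h(3))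
      also have "\<dots> = \<theta> (u A)" using expand by (simp add: u)
      finally show ?thesis using \<theta>(3) by simp
    qed
    moreover have "nrm (dual_space D) ?\<psi> \<le> 1"
    proof (rule Ds.dual_norm_le)
      fix f assume f: "f \<in> carrier D"
      let ?v = "\<lambda>\<alpha>\<in>I. if \<alpha> \<in> A \<inter> I then h \<alpha> (f \<alpha>) else 0"
      have v: "?v \<in> carrier E" by (rule conjunct1[OF expand])
      have "?\<psi> f = (\<Sum>\<alpha>\<in>A \<inter> I. h \<alpha> (f \<alpha>) * \<theta> (?e \<alpha>))"
        using f D_mem(2)[OF f] by (simp add: k mult.commute)
      also have "\<dots> = \<theta> ?v" by (rule conjunct2[OF expand, symmetric])
      also have "\<dots> \<le> nrm E ?v" using \<theta>(2)[OF v] by simp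
      also have "\<dots> \<le> nrm D f"
        unfolding nrm_D
        by (rule ideal_nrm_le[OF _ D_mem(1)[OF f]])
          (use h(2) D_mem(2)[OF f] component_nrm_nonneg in auto)
      finally show "?\<psi> f \<le> 1 * nrm D f" by simp
    qed (use Ds.dual_linear[OF \<psi>(1)] in auto)
    moreover have "\<Phi> ?\<psi> \<le> nrm (dual_space (dual_space D)) \<Phi> * nrm (dual_space D) ?\<psi>"
      by (rule DD.dual_le[OF \<Phi> \<psi>(1)])
    ultimately have "nrm E (u A) \<le> nrm (dual_space (dual_space D)) \<Phi>"
      using mult_left_mono[OF _ DD.dual_nrm_nonneg[OF \<Phi>], of "nrm (dual_space D) ?\<psi>" 1] by simp
    with mem show ?thesis by blast
  qed
  \<comment> \<open>A net over all sets: the value at sets with infinite trace on \<open>I\<close> only has to be bounded.\<close>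
  let ?w = "\<lambda>A. if finite (A \<inter> I) then u A else \<zero>\<^bsub>E\<^esub>"
  have w: "?w A \<in> carrier E" "nrm E (?w A) \<le> nrm (dual_space (dual_space D)) \<Phi>" for A
    using bound DD.dual_nrm_nonneg[OF \<Phi>] by auto
  have ev: "\<forall>\<^sub>F A in ?G. ?w A \<alpha> = nrm (X \<alpha>) (x \<alpha>)" if "\<alpha> \<in> I" for \<alpha>
    using that unfolding eventually_finite_subsets_at_top by (intro exI[of _ "{\<alpha>}"]) (auto simp: u)
  obtain z where z: "z \<in> carrier E" "\<And>\<alpha>. \<alpha> \<in> I \<Longrightarrow> z \<alpha> = nrm (X \<alpha>) (x \<alpha>)"
  proof (rule reflexive_coordinatewise_limit[OF refl finite_subsets_at_top_neq_bot w ev])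
    fix z assume "z \<in> carrier E" "\<And>\<alpha>. \<alpha> \<in> I \<Longrightarrow> z \<alpha> = nrm (X \<alpha>) (x \<alpha>)"
    then show thesis by (rule that)
  qed
  show ?thesis
    by (rule dominated(1)[OF _ _ z(1)]) (use x z(2) in auto)
qed

text \<open>The tail of \<open>\<psi>\<close> outside \<open>A\<close> is small in norm for some finite \<open>A\<close>.  Otherwise there are \<open>w\<^sub>A\<close> in the
  unit ball whose tails satisfy \<open>\<psi> \<ge> e\<close>.  The norm sequences of these tails form a bounded
  coordinatewise null net in \<open>E\<close>, and on them the functional given by \<open>(\<parallel>\<psi>\<^sub>\<alpha>\<parallel>)\<close> dominates \<open>\<psi>\<close>.\<close>
lemma reflexive_dual_tails:
  assumes refl: "reflexive_space E" and \<psi>: "\<psi> \<in> carrier (dual_space D)" and e: "0 < e"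
  shows "\<exists>A. finite A \<and> A \<subseteq> I \<and> (\<forall>f\<in>carrier D. \<psi> (truncation I D (- A) f) \<le> e * nrm D f)"
proof (rule ccontr)
  assume contra: "\<nexists>A. finite A \<and> A \<subseteq> I \<and> (\<forall>f\<in>carrier D. \<psi> (truncation I D (- A) f) \<le> e * nrm D f)"
  interpret Ds: normed_space D by (rule normed_space_D)
  let ?G = "finite_subsets_at_top I" and ?y = "dual_seq (component \<psi>)"
  have y: "?y \<in> carrier (kothe_dual I E)" by (rule component_norms_kothe(1)[OF \<psi>])
  have dominates: "\<psi> f \<le> sequence_functional I E ?y (norm_seq f)" if f: "f \<in> carrier D" for f
  proof -
    have "\<psi> f = (\<Sum>\<^sub>\<infinity>\<alpha>\<in>I. component \<psi> \<alpha> (f \<alpha>))"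
      using infsumI[OF component_has_sum[OF reflexive_vanishing_tails[OF refl] \<psi> f]] by simp
    also have "\<dots> \<le> (\<Sum>\<^sub>\<infinity>\<alpha>\<in>I. norm_seq f \<alpha> * ?y \<alpha>)"
    proof (rule infsum_mono[OF _ kothe_summable[OF y D_mem(1)[OF f]]])
      show "(\<lambda>\<alpha>. component \<psi> \<alpha> (f \<alpha>)) summable_on I"
        using component_has_sum[OF reflexive_vanishing_tails[OF refl] \<psi> f] by (rule has_sum_imp_summable)
      show "component \<psi> \<alpha> (f \<alpha>) \<le> norm_seq f \<alpha> * ?y \<alpha>" if "\<alpha> \<in> I" for \<alpha>
        using normed_space.dual_le[OF normed_component[OF that] component_mem[OF \<psi> that] D_mem(2)[OF f that]] that
        by (simp add: mult.commute)
    qed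
    finally show ?thesis using D_mem(1)[OF f] by (simp add: sequence_functional_def)
  qed
  have "\<exists>w\<in>carrier D. nrm D w \<le> 1 \<and> e \<le> \<psi> (truncation I D (- A) w)" if A: "finite A" "A \<subseteq> I" for A
  proof -
    obtain f where f: "f \<in> carrier D" "e * nrm D f < \<psi> (truncation I D (- A) f)"
      using contra A by (auto simp: not_le)
    have "\<psi> (truncation I D (- A) f) \<le> nrm (dual_space D) \<psi> * nrm D (truncation I D (- A) f)"
      by (rule Ds.dual_le[OF \<psi> truncation_D_mem[OF f(1)]])
    also have "\<dots> \<le> nrm (dual_space D) \<psi> * nrm D f"
      using truncation_D_nrm_le[OF f(1)] Ds.dual_nrm_nonneg[OF \<psi>] by (rule mult_left_mono)
    finally have "nrm D f \<noteq> 0" using f(2) by auto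
    then have pos: "0 < nrm D f" using Ds.nrm_nonneg[OF f(1)] by simp
    let ?w = "inverse (nrm D f) \<odot>\<^bsub>D\<^esub> f"
    have "truncation I D (- A) ?w = inverse (nrm D f) \<odot>\<^bsub>D\<^esub> truncation I D (- A) f"
      by (rule D_eqI) (auto simp: truncation_D_apply truncation_D_extensional D_extensional D_apply component_rules)
    then have "\<psi> (truncation I D (- A) ?w) = inverse (nrm D f) * \<psi> (truncation I D (- A) f)"
      using Ds.dual_smult[OF \<psi> truncation_D_mem[OF f(1)]] by simp
    moreover have "e \<le> inverse (nrm D f) * \<psi> (truncation I D (- A) f)"
      using f(2) pos by (simp add: field_simps)
    ultimately have "e \<le> \<psi> (truncation I D (- A) ?w)" by simp
    moreover have "?w \<in> carrier D" "nrm D ?w \<le> 1" using f(1) pos by (simp_all add: Ds.nrm_smult)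
    ultimately show ?thesis by blast
  qed
  then obtain w where w: "\<And>A. finite A \<Longrightarrow> A \<subseteq> I \<Longrightarrow> w A \<in> carrier D"
    "\<And>A. finite A \<Longrightarrow> A \<subseteq> I \<Longrightarrow> nrm D (w A) \<le> 1"
    "\<And>A. finite A \<Longrightarrow> A \<subseteq> I \<Longrightarrow> e \<le> \<psi> (truncation I D (- A) (w A))"
    by metis
  define v where "v A = (if finite A \<and> A \<subseteq> I then norm_seq (truncation I D (- A) (w A)) else \<zero>\<^bsub>E\<^esub>)" for A
  have v: "v A \<in> carrier E" "nrm E (v A) \<le> 1" for A
    using w(1,2)[of A] truncation_D_mem[of "w A" "- A"] truncation_D_nrm_le[of "w A" "- A"] D_mem(1)
    by (auto simp: v_def simp flip: nrm_D intro: order_trans)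
  have null: "\<forall>\<^sub>F A in ?G. v A \<alpha> = 0" if "\<alpha> \<in> I" for \<alpha>
    using that unfolding eventually_finite_subsets_at_top
    by (intro exI[of _ "{\<alpha>}"]) (auto simp: v_def truncation_D_apply normed_space.nrm_zero[OF normed_component])
  have "\<forall>\<^sub>F A in ?G. e \<le> sequence_functional I E ?y (v A)"
  proof (rule eventually_finite_subsets_at_top_weakI)
    fix A assume A: "finite A" "A \<subseteq> I"
    show "e \<le> sequence_functional I E ?y (v A)"
      using w(3)[OF A] dominates[OF truncation_D_mem[OF w(1)[OF A]], of "- A"] A by (simp add: v_def)
  qed
  moreover have "\<not> (\<forall>\<^sub>F A in ?G. e \<le> sequence_functional I E ?y (v A))"
    by (rule reflexive_coordinatewise_null[OF refl finite_subsets_at_top_neq_bot v null kothe_functional[OF y] e])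
  ultimately show False by blast
qed

text \<open>On a functional of finitely many coordinates, \<open>\<Phi>\<close> is evaluation at the family \<open>x\<close> of its
  coordinates.  Any \<open>\<psi>\<close> differs from such a functional by some \<open>\<rho>\<close> of norm at most \<open>e\<close>, and both
  \<open>\<Phi> \<rho>\<close> and \<open>\<rho> x\<close> are of order \<open>e\<close>.\<close>
theorem reflexive_direct_sum:
  assumes refl: "reflexive_space E" and refl_X: "\<And>\<alpha>. \<alpha> \<in> I \<Longrightarrow> reflexive_space (X \<alpha>)"
  shows "reflexive_space D"
proof (rule normed_space.reflexiveI[OF normed_space_D])
  interpret Ds: normed_space D by (rule normed_space_D)
  interpret DD: normed_space "dual_space D" by (rule Ds.normed_space_dual)
  fix \<Phi> assume \<Phi>: "\<Phi> \<in> carrier (dual_space (dual_space D))"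
  let ?N = "nrm (dual_space (dual_space D)) \<Phi>"
  obtain x where x: "\<And>\<alpha>. \<alpha> \<in> I \<Longrightarrow> x \<alpha> \<in> carrier (X \<alpha>)"
    and eval: "\<And>\<alpha> h. \<alpha> \<in> I \<Longrightarrow> h \<in> carrier (dual_space (X \<alpha>)) \<Longrightarrow> \<Phi> (lift \<alpha> h) = h (x \<alpha>)"
    using bidual_coordinates[OF refl_X \<Phi>] by metis
  let ?f = "restrict x I"
  have f: "?f \<in> carrier D" by (rule bidual_coordinates_mem[OF refl \<Phi> x eval])
  have approx: "\<bar>\<Phi> \<psi> - \<psi> ?f\<bar> \<le> e * (?N + nrm D ?f)"
    if \<psi>: "\<psi> \<in> carrier (dual_space D)" and e: "0 < e" for \<psi> e
  proof -
    have lin: "linear_functional D \<psi>" by (rule Ds.dual_linear[OF \<psi>])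
    obtain A where A: "finite A" "A \<subseteq> I"
      and tail: "\<And>f. f \<in> carrier D \<Longrightarrow> \<psi> (truncation I D (- A) f) \<le> e * nrm D f"
      using reflexive_dual_tails[OF refl \<psi> e] by metis
    let ?\<psi>A = "\<lambda>f\<in>carrier D. \<Sum>\<alpha>\<in>A. component \<psi> \<alpha> (f \<alpha>)"
    have sum: "\<psi> (truncation I D A f) = ?\<psi>A f" if f: "f \<in> carrier D" for f
      using linear_truncation[OF lin f A] A D_mem(2)[OF f] f by (auto simp: component_def intro!: sum.cong)
    have \<psi>A: "?\<psi>A \<in> carrier (dual_space D)" "\<Phi> ?\<psi>A = (\<Sum>\<alpha>\<in>A. \<Phi> (lift \<alpha> (component \<psi> \<alpha>)))"
      using bidual_finite_sum[OF DD.dual_linear[OF \<Phi>] A component_mem[OF \<psi>]] by auto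
    define \<rho> where "\<rho> = \<psi> \<ominus>\<^bsub>dual_space D\<^esub> ?\<psi>A"
    have \<rho>: "\<rho> \<in> carrier (dual_space D)" unfolding \<rho>_def using \<psi> \<psi>A(1) by (rule DD.M.minus_closed)
    have \<psi>_eq: "\<psi> = \<rho> \<oplus>\<^bsub>dual_space D\<^esub> ?\<psi>A"
      using \<psi> \<psi>A(1) by (simp add: \<rho>_def DD.M.minus_eq DD.M.a_assoc DD.M.l_neg)
    have \<psi>_apply: "\<psi> f = \<rho> f + ?\<psi>A f" if "f \<in> carrier D" for f
      using fun_cong[OF \<psi>_eq, of f] that by (simp add: dual_space_def)
    have "\<rho> f \<le> e * nrm D f" if f: "f \<in> carrier D" for f
    proof -
      have "\<psi> f = \<psi> (truncation I D A f) + \<psi> (truncation I D (- A) f)"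
        using lin truncation_D_split[OF f, of A] truncation_D_mem[OF f] unfolding linear_functional_def by metis
      then show ?thesis using \<psi>_apply[OF f] sum[OF f] tail[OF f] by simp
    qed
    then have small: "nrm (dual_space D) \<rho> \<le> e"
      using e by (intro Ds.dual_norm_le Ds.dual_linear[OF \<rho>]) auto
    have "\<Phi> ?\<psi>A = ?\<psi>A ?f"
      unfolding \<psi>A(2) using A f eval component_mem[OF \<psi>] by (auto intro!: sum.cong)
    then have "\<Phi> \<psi> - \<psi> ?f = \<Phi> \<rho> - \<rho> ?f"
      using DD.dual_add[OF \<Phi> \<rho> \<psi>A(1)] \<psi>_eq \<psi>_apply[OF f] by simp
    moreover have "\<bar>\<Phi> \<rho>\<bar> \<le> e * ?N"
      using DD.dual_abs_le[OF \<Phi> \<rho>] mult_left_mono[OF small DD.dual_nrm_nonneg[OF \<Phi>]]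
      by (simp add: mult.commute)
    moreover have "\<bar>\<rho> ?f\<bar> \<le> e * nrm D ?f"
      using Ds.dual_abs_le[OF \<rho> f] mult_right_mono[OF small Ds.nrm_nonneg[OF f]] by simp
    ultimately show ?thesis by (simp add: distrib_left)
  qed
  have "\<Phi> \<psi> = \<psi> ?f" if \<psi>: "\<psi> \<in> carrier (dual_space D)" for \<psi>
  proof -
    let ?c = "?N + nrm D ?f + 1"
    have c: "0 < ?c" using DD.dual_nrm_nonneg[OF \<Phi>] Ds.nrm_nonneg[OF f] by simp
    have "\<bar>\<Phi> \<psi> - \<psi> ?f\<bar> \<le> 0 + e" if e: "0 < e" for e
    proof -
      have "\<bar>\<Phi> \<psi> - \<psi> ?f\<bar> \<le> e / ?c * (?N + nrm D ?f)" by (rule approx[OF \<psi> divide_pos_pos[OF e c]])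
      also have "\<dots> \<le> e / ?c * ?c" using e c by (intro mult_left_mono) auto
      finally show ?thesis using c by simp
    qed
    then show ?thesis using field_le_epsilon[of "\<bar>\<Phi> \<psi> - \<psi> ?f\<bar>" 0] by simp
  qed
  then show "\<exists>x\<in>carrier D. \<forall>\<psi>\<in>carrier (dual_space D). \<Phi> \<psi> = \<psi> x" using f by blast
qed

end

section \<open>Duality for direct sums over Banach ideal spaces\<close>

theorem theorem3p13:
  fixes I :: "'i set" and X :: "'i \<Rightarrow> 'a nspace" and E :: "('i \<Rightarrow> real) nspace"
  assumes "countable I"
    and "\<And>\<alpha>. \<alpha> \<in> I \<Longrightarrow> banach_space (X \<alpha>)"
    and "\<And>\<alpha>. \<alpha> \<in> I \<Longrightarrow> carrier (X \<alpha>) \<noteq> {\<zero>\<^bsub>X \<alpha>\<^esub>}"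
    and "banach_ideal_space I E"
  shows "(order_continuous E (pointwise_le I) \<and> order_continuous (dual_space E) (dual_le I E) \<longrightarrow>
      (let D = direct_sum I E X;
           D' = direct_sum I (kothe_dual I E) (\<lambda>\<alpha>. dual_space (X \<alpha>))
       in (\<forall>g\<in>carrier D'. \<forall>f\<in>carrier D. (\<lambda>\<alpha>. g \<alpha> (f \<alpha>)) summable_on I) \<and>
          isometric_isomorphism D' (dual_space D)
            (\<lambda>g. \<lambda>f\<in>carrier D. \<Sum>\<^sub>\<infinity>\<alpha>\<in>I. g \<alpha> (f \<alpha>)))) \<and>
    (reflexive_space E \<and> (\<forall>\<alpha>\<in>I. reflexive_space (X \<alpha>)) \<longrightarrow>
      reflexive_space (direct_sum I E X))"
proof -
  interpret E: banach_ideal_space I E by fact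
  interpret ideal_direct_sum I E X
    by (intro ideal_direct_sum.intro ideal_direct_sum_axioms.intro assms(4) banach_space.axioms(1) assms(2))
  show ?thesis
  proof (intro conjI impI)
    assume oc: "order_continuous E (pointwise_le I) \<and> order_continuous (dual_space E) (dual_le I E)"
    have "isometric_isomorphism D' (dual_space D) pairing"
      using oc by (intro pairing_isometric_isomorphism E.order_continuous_vanishing_tails[OF assms(1)]) blast
    moreover have "pairing = (\<lambda>g. \<lambda>f\<in>carrier D. \<Sum>\<^sub>\<infinity>\<alpha>\<in>I. g \<alpha> (f \<alpha>))"
      by (rule ext) (rule pairing_def)
    ultimately show "let D = direct_sum I E X;
           D' = direct_sum I (kothe_dual I E) (\<lambda>\<alpha>. dual_space (X \<alpha>))
       in (\<forall>g\<in>carrier D'. \<forall>f\<in>carrier D. (\<lambda>\<alpha>. g \<alpha> (f \<alpha>)) summable_on I) \<and>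
          isometric_isomorphism D' (dual_space D) (\<lambda>g. \<lambda>f\<in>carrier D. \<Sum>\<^sub>\<infinity>\<alpha>\<in>I. g \<alpha> (f \<alpha>))"
      unfolding Let_def using pairing_summable(1) by simp
  next
    assume "reflexive_space E \<and> (\<forall>\<alpha>\<in>I. reflexive_space (X \<alpha>))"
    then show "reflexive_space (direct_sum I E X)" by (intro reflexive_direct_sum) auto
  qed
qed

end
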